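(* Assume the uncertainty set is a Cartesian product $\mathcal V=\prod_{G\in\mathcal G}\mathcal V_G$ of the groups' uncertainty sets, where $$\mathcal V_G=\{v_G\in\mathbb R^{|G|m}:(v_G-\bar v_{G,i})^\top S_{G,i}^{-1}(v_G-\bar v_{G,i})\le r_{G,i}^2\ (i=1,\dots,\ell),\ Q_Gv_G\succeq e_G,\ v_G\succeq0\}.$$ The robust group egalitarian welfare problem $$\max_{a\in\mathcal A}\ \min_{v\in\mathcal V}\ \min_{G\in\mathcal G}\ u_G(a,v)=\max_{a\in\mathcal A}\ \min_{v\in\mathcal V}\ \min_{G\in\mathcal G}\ a_G^\top v_G$$ is equivalent to solving $$\max_{\xi\in\Lambda,\ \lambda\in\mathbb R_{\ge0}^{g\times\ell},\ \beta\in\mathbb R_{\ge0}^{g\times k}}\ \min_{G\in\mathcal G}\ \ \beta_G^\top e_G+p_G^\top T_Gq_G-\tfrac14p_G^\top T_Gp_G+\sum_{i=1}^{\ell}\left(\lambda_{G,i}\bar v_{G,i}^\top S_{G,i}^{-1}\bar v_{G,i}-\lambda_{G,i}r_{G,i}^2\right)-q_G^\top T_Gq_G,$$ where for each group $G\in\mathcal G$, $p_G=\xi_G-Q_G^\top\beta_G$, $q_G=\sum_{i=1}^{\ell}\lambda_{G,i}S_{G,i}^{-1}\bar v_{G,i}$ and $T_G=\bigl(\sum_{i=1}^{\ell}\lambda_{G,i}S_{G,i}^{-1}\bigr)^{-1}$. The optimal allocation $a^*$ can be computed from the optimal $\xi^*$ of the latter problem by finding $a\in\mathcal A$ such that $a_G\preceq\xi^*_G$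 for every group $G\in\mathcal G$.
   Context: There are $n$ agents $N$, partitioned into $g$ groups $\mathcal G=\{G_1,\dots,G_g\}$, and $m$ item types $I$. Allocations and valuations are $n\times m$ matrices, vectorized in row-major order as $a,v\in\mathbb R^{nm}$; $x_G\in\mathbb R^{|G|m}$ is the restriction of a vector $x$ to the agents in $G$; $x_{j,i}$ is the entry of $x$ for agent $j$ and item $i$; $\lambda_G,\beta_G$ are the rows of $\lambda,\beta$ for group $G$. $\succeq,\preceq$ are coordinatewise. The set of feasible (continuous) allocations $\mathcal A$ consists of all $a\in\mathbb R_{\ge0}^{nm}$ with $\underline\kappa_j\le\sum_{i\in I}a_{j,i}\le\bar\kappa_j$ for each agent $j$, $\underline\psi_i\le\sum_{j\in N}a_{j,i}\le\bar\psi_i$ for each item $i$, and $a\preceq c$, for given bounds $\underline\kappa,\bar\kappa,\underline\psi,\bar\psi,c$. Group egalitarian welfare is the minimum over groups of group utility; the factor $1/|G|$ in the group utility is absorbed into the valuations and the uncertainty set, so the utility of $G$ is $u_G(a,v)=a_G^\top v_G$. The data of $\mathcal V_G$ are centers $\bar v_{G,i}\in\mathbb R_{\ge0}^{|G|m}$, positive semi-definite covariance matrices $S_{G,i}$ (whose inverses are used), radii $r_{G,i}\in\mathbb R$, $Q_G\in\mathbb R^{k\times|G|m}$ and $e_G\in\mathbb R^k$; the inner minimizations over $\mathcal V_G$ are taken to be strictly feasible (Slater's condition). The set $\Lambda$ is given as $$\Lambda\doteq\mathcal A-\mathbb R_{\ge0}^{nm}=\Bigl\{\xi\in\mathbb R^{nm}:\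 \sum_{i\in I}\xi_{j,i}\le\bar\kappa_j\ \forall j\in N,\ \ \sum_{j\in N}\xi_{j,i}\le\bar\psi_i\ \forall i\in I,\ \ \xi\preceq c\Bigr\}.$$
   Formalization: The recovery condition is corrected to ξ*_G ⪯ a_G; Λ is taken as A − R≥0^{nm} (the explicit description can be strictly larger); where λ_G = 0 and T_G does not exist, the objective is β_G^T e_G if p_G = 0 and −∞ otherwise, and the sup over points where all T_G exist is shown equal. *)

theory Defs
  imports
    "Jordan_Normal_Form.Gauss_Jordan_Elimination"
    "HOL-Library.Extended_Real"
    "HOL-Library.Disjoint_Sets"
begin

text \<open>
  Agents are \<open>{..<n}\<close>, item types \<open>{..<m}\<close>, and an \<open>n \<times> m\<close> matrix is its row-major vector of
  dimension \<open>n * m\<close>.  The order on \<^typ>\<open>real vec\<close> is the coordinatewise one.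
\<close>

definition entry :: "nat \<Rightarrow> real vec \<Rightarrow> nat \<Rightarrow> nat \<Rightarrow> real" where
  "entry m x j i = x $ (j * m + i)"

text \<open>The restriction \<open>x\<^sub>G\<close>, again row-major, with the agents of \<open>G\<close> in increasing order.\<close>

definition block :: "nat \<Rightarrow> nat set \<Rightarrow> real vec \<Rightarrow> real vec" where
  "block m G x =
     vec (card G * m) (\<lambda>t. entry m x (sorted_list_of_set G ! (t div m)) (t mod m))"

definition allocations ::
  "nat \<Rightarrow> nat \<Rightarrow> (nat \<Rightarrow> real) \<Rightarrow> (nat \<Rightarrow> real) \<Rightarrow> (nat \<Rightarrow> real) \<Rightarrow> (nat \<Rightarrow> real) \<Rightarrow> real vec
    \<Rightarrow> real vec set" where
  "allocations n m \<kappa>lo \<kappa>hi \<psi>lo \<psi>hi c =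
     {a \<in> carrier_vec (n * m).
        0\<^sub>v (n * m) \<le> a \<and>
        (\<forall>j<n. \<kappa>lo j \<le> (\<Sum>i<m. entry m a j i) \<and> (\<Sum>i<m. entry m a j i) \<le> \<kappa>hi j) \<and>
        (\<forall>i<m. \<psi>lo i \<le> (\<Sum>j<n. entry m a j i) \<and> (\<Sum>j<n. entry m a j i) \<le> \<psi>hi i) \<and>
        a \<le> c}"

text \<open>
  \<open>\<Lambda> = \<A> - \<real>\<^sub>\<ge>\<^sub>0\<^sup>n\<^sup>m\<close> is the set difference in the sense of Minkowski.  The upper-bound
  constraints \<open>\<Sum>\<^sub>i \<xi>\<^sub>j\<^sub>i \<le> \<kappa>hi j\<close>, \<open>\<Sum>\<^sub>j \<xi>\<^sub>j\<^sub>i \<le> \<psi>hi i\<close>, \<open>\<xi> \<le> c\<close> hold on this set but do not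
  characterise it in general: negative entries of \<open>\<xi>\<close> can hide a violation in the same row or
  column, and the lower bounds restrict which \<open>\<xi>\<close> lie below an allocation.
\<close>

definition lower_allocations :: "nat \<Rightarrow> real vec set \<Rightarrow> real vec set" where
  "lower_allocations N A = {a - s | a s. a \<in> A \<and> s \<in> carrier_vec N \<and> 0\<^sub>v N \<le> s}"

definition psd :: "nat \<Rightarrow> real mat \<Rightarrow> bool" where
  "psd d S \<longleftrightarrow> S \<in> carrier_mat d d \<and> transpose_mat S = S \<and>
     (\<forall>x \<in> carrier_vec d. 0 \<le> x \<bullet> (S *\<^sub>v x))"

text \<open>Unspecified unless the matrix is invertible.\<close>

definition minv :: "real mat \<Rightarrow> real mat" where
  "minv S = the (mat_inverse S)"

definition group_uncertainty ::
  "nat \<Rightarrow> nat \<Rightarrow> (nat \<Rightarrow> real vec) \<Rightarrow> (nat \<Rightarrow> real mat) \<Rightarrow> (nat \<Rightarrow> real) \<Rightarrow> real mat \<Rightarrow> real vec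
    \<Rightarrow> real vec set" where
  "group_uncertainty d l vb S r Q e =
     {v \<in> carrier_vec d.
        (\<forall>i<l. (v - vb i) \<bullet> (minv (S i) *\<^sub>v (v - vb i)) \<le> (r i)\<^sup>2) \<and>
        e \<le> Q *\<^sub>v v \<and> 0\<^sub>v d \<le> v}"

text \<open>The strict order of \<^typ>\<open>real vec\<close> is not coordinatewise, hence the explicit quantifiers.\<close>

definition strictly_feasible ::
  "nat \<Rightarrow> nat \<Rightarrow> nat \<Rightarrow> (nat \<Rightarrow> real vec) \<Rightarrow> (nat \<Rightarrow> real mat) \<Rightarrow> (nat \<Rightarrow> real) \<Rightarrow> real mat
    \<Rightarrow> real vec \<Rightarrow> bool" where
  "strictly_feasible d l k vb S r Q e \<longleftrightarrow>
     (\<exists>v \<in> carrier_vec d.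
        (\<forall>i<l. (v - vb i) \<bullet> (minv (S i) *\<^sub>v (v - vb i)) < (r i)\<^sup>2) \<and>
        (\<forall>s<k. e $ s < (Q *\<^sub>v v) $ s) \<and> (\<forall>t<d. 0 < v $ t))"

definition product_uncertainty ::
  "nat \<Rightarrow> nat \<Rightarrow> nat set set \<Rightarrow> (nat set \<Rightarrow> real vec set) \<Rightarrow> real vec set" where
  "product_uncertainty n m \<G> VG = {v \<in> carrier_vec (n * m). \<forall>G\<in>\<G>. block m G v \<in> VG G}"

definition group_utility :: "nat \<Rightarrow> nat set \<Rightarrow> real vec \<Rightarrow> real vec \<Rightarrow> real" where
  "group_utility m G a v = block m G a \<bullet> block m G v"

definition robust_welfare :: "nat \<Rightarrow> nat set set \<Rightarrow> real vec set \<Rightarrow> real vec \<Rightarrow> ereal" where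
  "robust_welfare m \<G> V a = (INF v\<in>V. ereal (MIN G\<in>\<G>. group_utility m G a v))"

definition weighted_precision :: "nat \<Rightarrow> nat \<Rightarrow> (nat \<Rightarrow> real mat) \<Rightarrow> real vec \<Rightarrow> real mat" where
  "weighted_precision d l S lam = mat d d (\<lambda>(s, t). \<Sum>i<l. lam $ i * minv (S i) $$ (s, t))"

definition dual_formula ::
  "nat \<Rightarrow> nat \<Rightarrow> (nat \<Rightarrow> real vec) \<Rightarrow> (nat \<Rightarrow> real mat) \<Rightarrow> (nat \<Rightarrow> real) \<Rightarrow> real mat \<Rightarrow> real vec
    \<Rightarrow> real vec \<Rightarrow> real vec \<Rightarrow> real vec \<Rightarrow> real" where
  "dual_formula d l vb S r Q e \<xi> lam \<beta> =
     (let p = \<xi> - transpose_mat Q *\<^sub>v \<beta>;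
          q = finsum_vec TYPE(real) d (\<lambda>i. lam $ i \<cdot>\<^sub>v (minv (S i) *\<^sub>v vb i)) {..<l};
          T = minv (weighted_precision d l S lam)
      in \<beta> \<bullet> e + p \<bullet> (T *\<^sub>v q) - 1/4 * (p \<bullet> (T *\<^sub>v p))
         + (\<Sum>i<l. lam $ i * (vb i \<bullet> (minv (S i) *\<^sub>v vb i)) - lam $ i * (r i)\<^sup>2)
         - q \<bullet> (T *\<^sub>v q))"

text \<open>
  For positive definite \<open>S\<^sub>i\<close> and \<open>\<lambda> \<ge> 0\<close>, the matrix \<open>\<Sum>\<^sub>i \<lambda>\<^sub>i S\<^sub>i\<^sup>-\<^sup>1\<close> is singular only at \<open>\<lambda> = 0\<close>,
  where the formula is undefined.  There it is extended by its upper semicontinuous limit, i.e.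
  \<open>p\<^sup>T T p\<close> is read as \<open>0\<close> for \<open>p = 0\<close> and as \<open>\<infinity>\<close> otherwise; this is also the infimum over \<open>v\<close> of
  the Lagrangian \<open>p\<^sup>T v + \<beta>\<^sup>T e\<close>.
\<close>

definition group_dual ::
  "nat \<Rightarrow> nat \<Rightarrow> (nat \<Rightarrow> real vec) \<Rightarrow> (nat \<Rightarrow> real mat) \<Rightarrow> (nat \<Rightarrow> real) \<Rightarrow> real mat \<Rightarrow> real vec
    \<Rightarrow> real vec \<Rightarrow> real vec \<Rightarrow> real vec \<Rightarrow> ereal" where
  "group_dual d l vb S r Q e \<xi> lam \<beta> =
     (if invertible_mat (weighted_precision d l S lam)
        then ereal (dual_formula d l vb S r Q e \<xi> lam \<beta>)
      else if \<xi> - transpose_mat Q *\<^sub>v \<beta> = 0\<^sub>v d then ereal (\<beta> \<bullet> e)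
      else - \<infinity>)"

text \<open>The rows \<open>\<lambda>\<^sub>G\<close> and \<open>\<beta>\<^sub>G\<close> of \<open>\<lambda>\<close> and \<open>\<beta>\<close> are given as functions of the group \<open>G\<close>.\<close>

type_synonym dual_point = "real vec \<times> (nat set \<Rightarrow> real vec) \<times> (nat set \<Rightarrow> real vec)"

definition dual_domain :: "nat set set \<Rightarrow> nat \<Rightarrow> nat \<Rightarrow> real vec set \<Rightarrow> dual_point set" where
  "dual_domain \<G> l k \<Lambda> =
     {(\<xi>, lam, \<beta>). \<xi> \<in> \<Lambda> \<and>
        (\<forall>G\<in>\<G>. lam G \<in> carrier_vec l \<and> 0\<^sub>v l \<le> lam G \<and> \<beta> G \<in> carrier_vec k \<and> 0\<^sub>v k \<le> \<beta> G)}"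

definition dual_welfare ::
  "nat \<Rightarrow> nat set set \<Rightarrow> nat \<Rightarrow> (nat set \<Rightarrow> nat \<Rightarrow> real vec) \<Rightarrow> (nat set \<Rightarrow> nat \<Rightarrow> real mat)
    \<Rightarrow> (nat set \<Rightarrow> nat \<Rightarrow> real) \<Rightarrow> (nat set \<Rightarrow> real mat) \<Rightarrow> (nat set \<Rightarrow> real vec)
    \<Rightarrow> dual_point \<Rightarrow> ereal" where
  "dual_welfare m \<G> l vb S r Q e = (\<lambda>(\<xi>, lam, \<beta>).
     MIN G\<in>\<G>. group_dual (card G * m) l (vb G) (S G) (r G) (Q G) (e G)
                (block m G \<xi>) (lam G) (\<beta> G))"

end

theory Submission
  imports Defs "Jordan_Normal_Form.Determinant"
begin

text \<open>
  For fixed multipliers \<open>\<lambda>, \<beta>\<close> of the ellipsoidal and linear constraints of \<open>\<V>\<^sub>G\<close> the Lagrangian of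
  \<open>min a\<^sub>G\<^sup>T v\<close> is a quadratic in \<open>v\<close>, and completing the square gives its minimum, the dual formula.
  The multiplier \<open>s\<^sub>G\<close> of \<open>v \<ge> 0\<close> only enters through \<open>\<xi> = a - s\<close>, which is why \<open>\<xi>\<close> ranges over
  \<open>\<A> - \<real>\<^sub>\<ge>\<^sub>0\<^sup>n\<^sup>m\<close>.  Weak duality is immediate: \<open>dual (\<xi>, \<lambda>, \<beta>) \<le> \<xi>\<^sub>G\<^sup>T v\<^sub>G \<le> a\<^sub>G\<^sup>T v\<^sub>G\<close> whenever
  \<open>\<xi> \<le> a\<close> and \<open>v \<in> \<V>\<close>.  For strong duality all groups use the same level, the robust welfare \<open>\<rho>\<close> of \<open>a\<close>:
  since \<open>\<V>\<close> is a product, \<open>\<rho> \<le> a\<^sub>G\<^sup>T v\<^sub>G\<close> on each \<open>\<V>\<^sub>G\<close>, and Slater's condition yields multipliers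
  with group dual value at least \<open>\<rho>\<close>.  The multipliers are found one constraint at a time by a
  convexity argument on segments, so no separation theorem is needed.
\<close>

subsection \<open>Lagrange multipliers under Slater's condition\<close>

text \<open>Convexity of the set and of the function in one predicate. The mixing operation is a
  parameter because vectors of all dimensions share the type \<open>real vec\<close>, so mixing is
  meaningful only inside one carrier.\<close>

definition convex_along :: "(real \<Rightarrow> 'a \<Rightarrow> 'a \<Rightarrow> 'a) \<Rightarrow> 'a set \<Rightarrow> ('a \<Rightarrow> real) \<Rightarrow> bool" where
  "convex_along mix C f \<longleftrightarrow>
     (\<forall>x\<in>C. \<forall>y\<in>C. \<forall>t. 0 \<le> t \<and> t \<le> 1 \<longrightarrow>
        mix t x y \<in> C \<and> f (mix t x y) \<le> t * f x + (1 - t) * f y)"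

lemma convex_alongD:
  assumes "convex_along mix C f" "x \<in> C" "y \<in> C" "0 \<le> t" "t \<le> 1"
  shows "mix t x y \<in> C" "f (mix t x y) \<le> t * f x + (1 - t) * f y"
  using assms unfolding convex_along_def by blast+

lemma convex_along_add_scaled:
  assumes "convex_along mix C f" "convex_along mix C g" "0 \<le> u"
  shows "convex_along mix C (\<lambda>x. f x + u * g x)"
  unfolding convex_along_def
proof (intro ballI allI impI conjI)
  fix x y t assume x: "x \<in> C" and y: "y \<in> C" and t: "0 \<le> t \<and> (t::real) \<le> 1"
  show "mix t x y \<in> C" using convex_alongD(1)[OF assms(1) x y] t by blast
  have "f (mix t x y) \<le> t * f x + (1 - t) * f y" "g (mix t x y) \<le> t * g x + (1 - t) * g y"
    using convex_alongD(2)[OF assms(1) x y] convex_alongD(2)[OF assms(2) x y] t by blast+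
  moreover have "u * g (mix t x y) \<le> u * (t * g x + (1 - t) * g y)"
    using assms(3) calculation(2) by (rule mult_left_mono[rotated])
  ultimately show "f (mix t x y) + u * g (mix t x y)
      \<le> t * (f x + u * g x) + (1 - t) * (f y + u * g y)"
    by (simp add: algebra_simps)
qed

text \<open>Sublevel sets of convex functions are convex, so some constraints can be moved into the
  domain while another one is being eliminated.\<close>

lemma convex_along_sublevel:
  assumes f: "convex_along mix C f" and g: "\<And>i. i \<in> K \<Longrightarrow> convex_along mix C (g i)"
  shows "convex_along mix {x \<in> C. \<forall>i\<in>K. g i x \<le> 0} f"
  unfolding convex_along_def
proof (intro ballI allI impI conjI)
  fix x y t
  assume x: "x \<in> {x \<in> C. \<forall>i\<in>K. g i x \<le> 0}" and y: "y \<in> {x \<in> C. \<forall>i\<in>K. g i x \<le> 0}"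
    and t: "0 \<le> t \<and> (t::real) \<le> 1"
  have "g i (mix t x y) \<le> 0" if "i \<in> K" for i
  proof -
    have "g i (mix t x y) \<le> t * g i x + (1 - t) * g i y"
      using convex_alongD(2)[OF g[OF that]] x y t by blast
    also have "\<dots> \<le> 0"
      using x y t that by (intro add_nonpos_nonpos mult_nonneg_nonpos) auto
    finally show ?thesis .
  qed
  thus "mix t x y \<in> {x \<in> C. \<forall>i\<in>K. g i x \<le> 0}"
    using convex_alongD(1)[OF f] x y t by blast
  show "f (mix t x y) \<le> t * f x + (1 - t) * f y"
    using convex_alongD(2)[OF f] x y t by blast
qed

text \<open>A multiplier \<open>u\<close> has to satisfy \<open>- f x / g x \<le> u\<close> wherever
  \<open>g x > 0\<close> and \<open>u \<le> f y / (- g y)\<close> wherever \<open>g y < 0\<close>.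
  By \<open>chord\<close> every such lower bound lies below every such upper bound, so the infimum
  of the upper bounds works. The Slater point ensures that there is an upper bound.\<close>

lemma single_multiplier:
  fixes f g :: "'a \<Rightarrow> real"
  assumes f: "convex_along mix C f" and g: "convex_along mix C g"
    and x0: "x0 \<in> C" "g x0 < 0"
    and nonneg: "\<And>x. x \<in> C \<Longrightarrow> g x \<le> 0 \<Longrightarrow> 0 \<le> f x"
  shows "\<exists>u\<ge>0. \<forall>x\<in>C. 0 \<le> f x + u * g x"
proof -
  \<comment> \<open>The segment from \<open>x\<close> to \<open>y\<close> meets the sublevel set where the chord of \<open>g\<close> vanishes.\<close>
  have chord: "- f x / g x \<le> f y / (- g y)"
    if x: "x \<in> C" "g x > 0" and y: "y \<in> C" "g y < 0" for x y
  proof -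
    define t where "t = - g y / (g x - g y)"
    have t: "0 \<le> t" "t \<le> 1" using x y by (auto simp: t_def field_simps)
    have "g (mix t x y) \<le> t * g x + (1 - t) * g y"
      by (rule convex_alongD(2)[OF g x(1) y(1) t])
    also have "\<dots> = 0" using x y by (simp add: t_def field_simps)
    finally have "0 \<le> f (mix t x y)"
      using nonneg convex_alongD(1)[OF g x(1) y(1) t] by blast
    also have "\<dots> \<le> t * f x + (1 - t) * f y"
      by (rule convex_alongD(2)[OF f x(1) y(1) t])
    also have "1 - t = g x / (g x - g y)" using x y by (simp add: t_def field_simps)
    also have "t * f x + g x / (g x - g y) * f y = (g x * f y - g y * f x) / (g x - g y)"
      by (simp add: t_def diff_divide_distrib)
    finally have "0 \<le> g x * f y - g y * f x"
      using x y by (simp add: zero_le_divide_iff)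
    thus ?thesis using x y by (simp add: field_simps)
  qed
  define Y where "Y = {y \<in> C. g y < 0}"
  define u where "u = (INF y\<in>Y. f y / (- g y))"
  have Y: "Y \<noteq> {}" using x0 by (auto simp: Y_def)
  have ratio: "0 \<le> f y / (- g y)" if "y \<in> Y" for y
    using that nonneg[of y] unfolding Y_def by (intro divide_nonneg_pos) auto
  have bdd: "bdd_below ((\<lambda>y. f y / (- g y)) ` Y)"
    using ratio by (intro bdd_belowI2[where m = 0])
  have "0 \<le> u" unfolding u_def using Y ratio by (intro cINF_greatest)
  moreover have "0 \<le> f x + u * g x" if x: "x \<in> C" for x
  proof (cases "g x" "0 :: real" rule: linorder_cases)
    case less
    hence "u \<le> f x / (- g x)"
      unfolding u_def using bdd x by (intro cINF_lower) (auto simp: Y_def)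
    thus ?thesis using less by (simp add: field_simps)
  next
    case equal
    thus ?thesis using nonneg[OF x] by simp
  next
    case greater
    have "- f x / g x \<le> u"
      unfolding u_def using Y chord[OF x greater] by (intro cINF_greatest) (auto simp: Y_def)
    thus ?thesis using greater by (simp add: field_simps)
  qed
  ultimately show ?thesis by blast
qed

text \<open>Induction on the constraints. \<open>single_multiplier\<close> eliminates
  \<open>g j\<close> on the domain \<open>D\<close> where the remaining constraints hold; then
  \<open>f + w * g j\<close> is nonnegative on \<open>D\<close>, and the induction hypothesis for
  this new objective yields the other multipliers on all of \<open>C\<close>. Hence \<open>f\<close>
  is generalized.\<close>

lemma multipliers:
  fixes f :: "'a \<Rightarrow> real" and g :: "'i \<Rightarrow> 'a \<Rightarrow> real"
  assumes "finite K" and "convex_along mix C f"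
    and "\<And>i. i \<in> K \<Longrightarrow> convex_along mix C (g i)"
    and "x0 \<in> C" "\<And>i. i \<in> K \<Longrightarrow> g i x0 < 0"
    and "\<And>x. x \<in> C \<Longrightarrow> (\<And>i. i \<in> K \<Longrightarrow> g i x \<le> 0) \<Longrightarrow> 0 \<le> f x"
  shows "\<exists>u. (\<forall>i\<in>K. 0 \<le> u i) \<and> (\<forall>x\<in>C. 0 \<le> f x + (\<Sum>i\<in>K. u i * g i x))"
  using assms
proof (induction K arbitrary: f rule: finite_induct)
  case empty
  thus ?case by auto
next
  case (insert j K)
  define D where "D = {x \<in> C. \<forall>i\<in>K. g i x \<le> 0}"
  have "convex_along mix D f" "convex_along mix D (g j)"
    unfolding D_def using insert.prems(1,2) by (intro convex_along_sublevel; blast)+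
  moreover have "x0 \<in> D" "g j x0 < 0"
    using insert.prems(3,4) by (auto simp: D_def intro: less_imp_le)
  moreover have "0 \<le> f x" if "x \<in> D" "g j x \<le> 0" for x
    using that insert.prems(5)[of x] by (auto simp: D_def)
  ultimately obtain w where w: "0 \<le> w" "\<And>x. x \<in> D \<Longrightarrow> 0 \<le> f x + w * g j x"
    using single_multiplier[of mix D f "g j" x0] by blast
  have "\<exists>u. (\<forall>i\<in>K. 0 \<le> u i) \<and>
      (\<forall>x\<in>C. 0 \<le> (f x + w * g j x) + (\<Sum>i\<in>K. u i * g i x))"
    using insert.prems w by (intro insert.IH convex_along_add_scaled) (auto simp: D_def)
  then obtain u where u: "\<And>i. i \<in> K \<Longrightarrow> 0 \<le> u i"
    "\<And>x. x \<in> C \<Longrightarrow> 0 \<le> (f x + w * g j x) + (\<Sum>i\<in>K. u i * g i x)" by blast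
  have "(\<Sum>i\<in>insert j K. (u(j := w)) i * g i x) = w * g j x + (\<Sum>i\<in>K. u i * g i x)" for x
    using insert.hyps by simp (intro sum.cong, auto)
  thus ?case using u w(1) by (intro exI[of _ "u(j := w)"]) (auto simp: add.assoc)
qed

subsection \<open>Positive semidefinite forms\<close>

text \<open>\<open>invertible_mat\<close> gives a two-sided inverse whose dimensions are read off
  from the two products. This makes \<open>A\<close> a unit of the matrix ring, so
  \<open>mat_inverse\<close> does not return \<open>None\<close> and \<open>the\<close> in
  \<open>minv\<close> is well defined.\<close>

lemma minv_inverse:
  assumes A: "A \<in> carrier_mat d d" and inv: "invertible_mat A"
  shows "minv A \<in> carrier_mat d d" "A * minv A = 1\<^sub>m d" "minv A * A = 1\<^sub>m d"
proof -
  from inv obtain B where B: "A * B = 1\<^sub>m (dim_row A)" "B * A = 1\<^sub>m (dim_row B)"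
    unfolding invertible_mat_def inverts_mat_def by blast
  have "dim_row B = d" using B(2) A
    by (metis carrier_matD(2) index_mult_mat(3) index_one_mat(3))
  moreover have "dim_col B = d" using B(1) A
    by (metis carrier_matD(1) index_mult_mat(3) index_one_mat(3))
  ultimately have "B \<in> carrier_mat d d" by auto
  hence "A \<in> Units (ring_mat TYPE(real) d ())"
    using A B by (auto simp: Units_def ring_mat_def)
  then obtain C where "mat_inverse A = Some C"
    using mat_inverse(1)[OF A, of "()"] by (cases "mat_inverse A") auto
  thus "minv A \<in> carrier_mat d d" "A * minv A = 1\<^sub>m d" "minv A * A = 1\<^sub>m d"
    using mat_inverse(2)[OF A] by (auto simp: minv_def)
qed

lemma minv_cancel:
  assumes A: "A \<in> carrier_mat d d" and inv: "invertible_mat A" and x: "x \<in> carrier_vec d"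
  shows "A *\<^sub>v (minv A *\<^sub>v x) = x" "minv A *\<^sub>v (A *\<^sub>v x) = x"
  using minv_inverse[OF A inv] A x
  by (metis assoc_mult_mat_vec one_mult_mat_vec)+

lemma invertible_if_injective:
  fixes A :: "real mat"
  assumes A: "A \<in> carrier_mat d d"
    and inj: "\<And>x. x \<in> carrier_vec d \<Longrightarrow> A *\<^sub>v x = 0\<^sub>v d \<Longrightarrow> x = 0\<^sub>v d"
  shows "invertible_mat A"
proof -
  have "det A \<noteq> 0" using det_0_iff_vec_prod_zero_field[OF A] inj by blast
  from det_non_zero_imp_unit[OF A this, of "()"] obtain B where
    "B \<in> carrier_mat d d" "A * B = 1\<^sub>m d" "B * A = 1\<^sub>m d"
    by (auto simp: Units_def ring_mat_def)
  thus ?thesis using A unfolding invertible_mat_def inverts_mat_def by auto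
qed

lemma symmetric_form_commute:
  fixes A :: "real mat"
  assumes "A \<in> carrier_mat d d" "transpose_mat A = A" "x \<in> carrier_vec d" "y \<in> carrier_vec d"
  shows "x \<bullet> (A *\<^sub>v y) = y \<bullet> (A *\<^sub>v x)"
  using transpose_vec_mult_scalar[of A d d y x] assms
  by (metis comm_scalar_prod mult_mat_vec_carrier)

text \<open>Transposing \<open>A * minv A = 1\<close> shows that the transpose of
  \<open>minv A\<close> is a left inverse of \<open>A\<close>, and a left inverse equals the right
  inverse.\<close>

lemma minv_symmetric:
  assumes A: "A \<in> carrier_mat d d" and inv: "invertible_mat A" and sym: "transpose_mat A = A"
  shows "transpose_mat (minv A) = minv A"
proof -
  note I = minv_inverse[OF A inv]
  have T: "transpose_mat (minv A) \<in> carrier_mat d d" using I by simp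
  have "transpose_mat (minv A) * A = 1\<^sub>m d"
    using transpose_mult[OF A I(1)] sym I(2) by simp
  hence "(transpose_mat (minv A) * A) * minv A = minv A" using I by simp
  thus ?thesis using assoc_mult_mat[OF T A I(1)] I T by simp
qed

text \<open>The carrier premises of these rules mention a dimension that does not occur in their
  left-hand sides; each use supplies it through \<open>where d = d\<close>.\<close>

lemmas vec_bilinear_simps =
  add_scalar_prod_distrib[of _ d] scalar_prod_add_distrib[of _ d]
  minus_scalar_prod_distrib[of _ d] scalar_prod_minus_distrib[of _ d]
  mult_add_distrib_mat_vec[of _ d d] mult_minus_distrib_mat_vec[of _ d d]
  mult_mat_vec[of _ d d] smult_scalar_prod_distrib[of _ d] scalar_prod_smult_distrib[of _ d]
  for d

text \<open>With \<open>y = A x\<close>, the form at \<open>x + t y\<close> is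
  \<open>t^2 (y, A y) + 2 t (y, y)\<close>. For small negative \<open>t\<close> the linear term
  dominates, which contradicts nonnegativity unless \<open>y = 0\<close>.\<close>

lemma psd_null_vector:
  assumes A: "psd d A" and x: "x \<in> carrier_vec d" and null: "x \<bullet> (A *\<^sub>v x) = 0"
  shows "A *\<^sub>v x = 0\<^sub>v d"
proof -
  define y where "y = A *\<^sub>v x"
  have cA: "A \<in> carrier_mat d d" and sym: "transpose_mat A = A"
    and nonneg: "\<And>z. z \<in> carrier_vec d \<Longrightarrow> 0 \<le> z \<bullet> (A *\<^sub>v z)"
    using A by (auto simp: psd_def)
  have y: "y \<in> carrier_vec d" using cA x by (simp add: y_def)
  have quad: "0 \<le> t\<^sup>2 * (y \<bullet> (A *\<^sub>v y)) + 2 * t * (y \<bullet> y)" for t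
  proof -
    have "0 \<le> (x + t \<cdot>\<^sub>v y) \<bullet> (A *\<^sub>v (x + t \<cdot>\<^sub>v y))" using x y by (intro nonneg) simp
    also have "\<dots> = t\<^sup>2 * (y \<bullet> (A *\<^sub>v y)) + 2 * t * (y \<bullet> (A *\<^sub>v x))"
      using x y cA null symmetric_form_commute[OF cA sym x y]
      by (simp add: vec_bilinear_simps[where d = d] power2_eq_square algebra_simps)
    finally show ?thesis by (simp add: y_def)
  qed
  define q where "q = y \<bullet> (A *\<^sub>v y)"
  define s where "s = y \<bullet> y"
  have "s = 0"
  proof (rule ccontr)
    assume "s \<noteq> 0"
    moreover have "0 \<le> s" unfolding s_def scalar_prod_def by (intro sum_nonneg) simp
    moreover have q0: "0 \<le> q" unfolding q_def by (intro nonneg y)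
    ultimately have s: "0 < s" by simp
    \<comment> \<open>With \<open>t = - w\<close> the quadratic becomes
      \<open>- w^2 (q + 2)\<close>, which is negative; the \<open>+ 1\<close> covers
      \<open>q = 0\<close>.\<close>
    define w where "w = s / (q + 1)"
    have w: "0 < w" "s = w * (q + 1)" using s q0 by (auto simp: w_def)
    have "0 \<le> w\<^sup>2 * q + 2 * (- w) * s" using quad[of "- w"] by (simp add: q_def s_def)
    also have "\<dots> = w\<^sup>2 * (q - 2 * (q + 1))"
      by (simp add: w(2) power2_eq_square algebra_simps)
    finally have "0 \<le> q - 2 * (q + 1)" using w(1) by (simp add: zero_le_mult_iff)
    thus False using q0 by simp
  qed
  hence "\<forall>i<d. y $ i * y $ i = 0"
    using y unfolding s_def scalar_prod_def by (simp add: sum_nonneg_eq_0_iff)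
  thus ?thesis using y unfolding y_def[symmetric] by (intro eq_vecI) auto
qed

text \<open>The form of \<open>minv A\<close> at \<open>x\<close> is the form of \<open>A\<close> at
  \<open>minv A x\<close>, so nonnegativity carries over. If it vanishes,
  \<open>psd_null_vector\<close> gives \<open>x = A (minv A x) = 0\<close>. Thus the inverse of an
  invertible semidefinite matrix is positive definite.\<close>

lemma psd_minv:
  assumes A: "psd d A" and inv: "invertible_mat A"
  shows "psd d (minv A)"
    and "\<And>x. x \<in> carrier_vec d \<Longrightarrow> x \<bullet> (minv A *\<^sub>v x) = 0 \<Longrightarrow> x = 0\<^sub>v d"
proof -
  have cA: "A \<in> carrier_mat d d" and sym: "transpose_mat A = A"
    and nonneg: "\<And>z. z \<in> carrier_vec d \<Longrightarrow> 0 \<le> z \<bullet> (A *\<^sub>v z)"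
    using A by (auto simp: psd_def)
  note I = minv_inverse[OF cA inv]
  have form: "x \<bullet> (minv A *\<^sub>v x) = (minv A *\<^sub>v x) \<bullet> (A *\<^sub>v (minv A *\<^sub>v x))"
    if "x \<in> carrier_vec d" for x
    using that I(1) by (simp add: minv_cancel[OF cA inv] comm_scalar_prod[of _ d])
  show "psd d (minv A)"
    unfolding psd_def using I(1) minv_symmetric[OF cA inv sym] nonneg
    by (auto simp: form)
  fix x assume x: "x \<in> carrier_vec d" and "x \<bullet> (minv A *\<^sub>v x) = 0"
  hence "A *\<^sub>v (minv A *\<^sub>v x) = 0\<^sub>v d"
    using I(1) by (intro psd_null_vector[OF A]) (auto simp: form[OF x])
  thus "x = 0\<^sub>v d" using minv_cancel[OF cA inv x] by simp
qed

section \<open>Convexity of the constraint functions\<close>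

definition convex_comb :: "real \<Rightarrow> real vec \<Rightarrow> real vec \<Rightarrow> real vec" where
  "convex_comb t x y = t \<cdot>\<^sub>v x + (1 - t) \<cdot>\<^sub>v y"

lemma convex_along_affine:
  assumes "b \<in> carrier_vec d"
  shows "convex_along convex_comb (carrier_vec d) (\<lambda>x. u + b \<bullet> x)"
  using assms unfolding convex_along_def convex_comb_def
  by (auto simp: vec_bilinear_simps[where d = d] algebra_simps)

text \<open>The convexity gap of a quadratic form is exactly \<open>t (1 - t)\<close> times the form
  at \<open>x - y\<close>, hence nonnegative.\<close>

lemma convex_along_quadratic:
  assumes A: "psd d A" and b: "b \<in> carrier_vec d"
  shows "convex_along convex_comb (carrier_vec d) (\<lambda>x. (x - b) \<bullet> (A *\<^sub>v (x - b)) - u)"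
  unfolding convex_along_def
proof (intro ballI allI impI conjI)
  have cA: "A \<in> carrier_mat d d" and sym: "transpose_mat A = A"
    and nonneg: "\<And>z. z \<in> carrier_vec d \<Longrightarrow> 0 \<le> z \<bullet> (A *\<^sub>v z)"
    using A by (auto simp: psd_def)
  fix x y :: "real vec" and t :: real
  assume x: "x \<in> carrier_vec d" and y: "y \<in> carrier_vec d" and t: "0 \<le> t \<and> t \<le> 1"
  show "convex_comb t x y \<in> carrier_vec d" using x y by (simp add: convex_comb_def)
  define x' y' where "x' = x - b" and "y' = y - b"
  have xy': "x' \<in> carrier_vec d" "y' \<in> carrier_vec d" using x y b by (auto simp: x'_def y'_def)
  have "convex_comb t x y - b = t \<cdot>\<^sub>v x' + (1 - t) \<cdot>\<^sub>v y'"
    using x y b by (intro eq_vecI) (auto simp: convex_comb_def x'_def y'_def algebra_simps)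
  hence "(convex_comb t x y - b) \<bullet> (A *\<^sub>v (convex_comb t x y - b))
      = t * (x' \<bullet> (A *\<^sub>v x')) + (1 - t) * (y' \<bullet> (A *\<^sub>v y'))
        - t * (1 - t) * ((x' - y') \<bullet> (A *\<^sub>v (x' - y')))"
    using xy' cA symmetric_form_commute[OF cA sym xy']
    by (simp add: vec_bilinear_simps[where d = d] algebra_simps)
  moreover have "0 \<le> t * (1 - t) * ((x' - y') \<bullet> (A *\<^sub>v (x' - y')))"
    using t nonneg[of "x' - y'"] xy' by simp
  ultimately show "(convex_comb t x y - b) \<bullet> (A *\<^sub>v (convex_comb t x y - b)) - u
      \<le> t * ((x - b) \<bullet> (A *\<^sub>v (x - b)) - u) + (1 - t) * ((y - b) \<bullet> (A *\<^sub>v (y - b)) - u)"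
    by (simp add: x'_def y'_def algebra_simps)
qed

subsection \<open>Duality for one group\<close>

lemma scalar_prod_nonneg:
  fixes x y :: "real vec"
  assumes "0\<^sub>v d \<le> x" "0\<^sub>v d \<le> y"
  shows "0 \<le> x \<bullet> y"
  using assms by (auto simp: less_eq_vec_def scalar_prod_def intro!: sum_nonneg)

lemma scalar_prod_mono:
  fixes x y z :: "real vec"
  assumes "x \<le> y" "0\<^sub>v d \<le> z" "y \<in> carrier_vec d"
  shows "x \<bullet> z \<le> y \<bullet> z"
  using assms
  by (auto simp: less_eq_vec_def scalar_prod_def intro!: sum_mono mult_right_mono)

locale ellipsoidal_data =
  fixes d l k :: nat and vb :: "nat \<Rightarrow> real vec" and S :: "nat \<Rightarrow> real mat"
    and r :: "nat \<Rightarrow> real" and Q :: "real mat" and e :: "real vec"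
  assumes center: "i < l \<Longrightarrow> vb i \<in> carrier_vec d"
    and cov: "i < l \<Longrightarrow> psd d (S i)" "i < l \<Longrightarrow> invertible_mat (S i)"
    and Q: "Q \<in> carrier_mat k d" and e: "e \<in> carrier_vec k"
begin

abbreviation P :: "nat \<Rightarrow> real mat" where "P i \<equiv> minv (S i)"
abbreviation W :: "real vec \<Rightarrow> real mat" where "W \<equiv> weighted_precision d l S"

text \<open>There is no term for \<open>v \<ge> 0\<close>: its multiplier \<open>s\<close> is
  absorbed into the linear coefficient, with \<open>\<xi> = a - s\<close>.\<close>

definition lagrangian :: "real vec \<Rightarrow> real vec \<Rightarrow> real vec \<Rightarrow> real vec \<Rightarrow> real" where
  "lagrangian \<xi> lam \<beta> v = \<xi> \<bullet> v + \<beta> \<bullet> (e - Q *\<^sub>v v)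
     + (\<Sum>i<l. lam $ i * ((v - vb i) \<bullet> (P i *\<^sub>v (v - vb i)) - (r i)\<^sup>2))"

lemma precision:
  assumes "i < l"
  shows "psd d (P i)" "P i \<in> carrier_mat d d" "transpose_mat (P i) = P i"
    "x \<in> carrier_vec d \<Longrightarrow> 0 \<le> x \<bullet> (P i *\<^sub>v x)"
    "x \<in> carrier_vec d \<Longrightarrow> x \<bullet> (P i *\<^sub>v x) = 0 \<Longrightarrow> x = 0\<^sub>v d"
  using psd_minv[OF cov(1)[OF assms] cov(2)[OF assms]] by (auto simp: psd_def)

section \<open>The weighted precision matrix\<close>

lemma weighted_precision_carrier: "W lam \<in> carrier_mat d d"
  by (simp add: weighted_precision_def)

text \<open>\<open>W\<close> is defined entrywise; exchanging the sums reduces its bilinear form to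
  those of the \<open>P i\<close>, from which nonnegativity and invertibility follow.\<close>

lemma weighted_precision_form:
  assumes x: "x \<in> carrier_vec d" and y: "y \<in> carrier_vec d"
  shows "x \<bullet> (W lam *\<^sub>v y) = (\<Sum>i<l. lam $ i * (x \<bullet> (P i *\<^sub>v y)))"
proof -
  have "x \<bullet> (W lam *\<^sub>v y) = (\<Sum>s<d. \<Sum>t<d. \<Sum>i<l. x $ s * (lam $ i * P i $$ (s, t) * y $ t))"
    using x y
    by (simp add: scalar_prod_def weighted_precision_def sum_distrib_left sum_distrib_right
        atLeast0LessThan)
  also have "\<dots> = (\<Sum>s<d. \<Sum>i<l. \<Sum>t<d. x $ s * (lam $ i * P i $$ (s, t) * y $ t))"
    by (intro sum.cong refl sum.swap)
  also have "\<dots> = (\<Sum>i<l. \<Sum>s<d. \<Sum>t<d. x $ s * (lam $ i * P i $$ (s, t) * y $ t))"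
    by (rule sum.swap)
  also have "\<dots> = (\<Sum>i<l. lam $ i * (x \<bullet> (P i *\<^sub>v y)))"
  proof (intro sum.cong refl)
    fix i assume "i \<in> {..<l}"
    hence "P i \<in> carrier_mat d d" by (intro precision(2)) simp
    thus "(\<Sum>s<d. \<Sum>t<d. x $ s * (lam $ i * P i $$ (s, t) * y $ t)) = lam $ i * (x \<bullet> (P i *\<^sub>v y))"
      using x y
      by (simp add: scalar_prod_def sum_distrib_left atLeast0LessThan mult_ac)
  qed
  finally show ?thesis .
qed

lemma weighted_precision_symmetric: "transpose_mat (W lam) = W lam"
proof (rule eq_matI)
  fix s t assume st: "s < dim_row (W lam)" "t < dim_col (W lam)"
  have "P i $$ (t, s) = P i $$ (s, t)" if "i < l" for i
  proof -
    have "transpose_mat (P i) $$ (s, t) = P i $$ (t, s)"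
      using precision(2)[OF that] st by (simp add: weighted_precision_def)
    thus ?thesis using precision(3)[OF that] by simp
  qed
  thus "transpose_mat (W lam) $$ (s, t) = W lam $$ (s, t)"
    using st by (simp add: weighted_precision_def)
qed (auto simp: weighted_precision_def)

lemma weighted_precision_nonneg:
  assumes "0\<^sub>v l \<le> lam" "x \<in> carrier_vec d"
  shows "0 \<le> x \<bullet> (W lam *\<^sub>v x)"
  unfolding weighted_precision_form[OF assms(2,2)]
  using assms by (intro sum_nonneg mult_nonneg_nonneg precision(4)) (auto simp: less_eq_vec_def)

text \<open>A vector in the kernel makes a sum of nonnegative terms vanish, so the term with nonzero
  weight vanishes, and definiteness of that precision forces the vector to be zero. Read
  contrapositively, a singular \<open>W lam\<close> means that all weights are zero.\<close>

lemma weighted_precision_invertible: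
  assumes lam: "0\<^sub>v l \<le> lam" and pos: "i < l" "lam $ i \<noteq> 0"
  shows "invertible_mat (W lam)"
proof (rule invertible_if_injective[OF weighted_precision_carrier])
  fix x :: "real vec" assume x: "x \<in> carrier_vec d" and null: "W lam *\<^sub>v x = 0\<^sub>v d"
  have "(\<Sum>i<l. lam $ i * (x \<bullet> (P i *\<^sub>v x))) = 0"
    using weighted_precision_form[OF x x, of lam] x by (simp add: null)
  moreover have "0 \<le> lam $ i * (x \<bullet> (P i *\<^sub>v x))" if "i < l" for i
    using lam that precision(4)[OF that x] by (auto simp: less_eq_vec_def)
  ultimately have "lam $ i * (x \<bullet> (P i *\<^sub>v x)) = 0"
    using pos(1) sum_nonneg_eq_0_iff[of "{..<l}" "\<lambda>i. lam $ i * (x \<bullet> (P i *\<^sub>v x))"] by simp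
  thus "x = 0\<^sub>v d" using pos precision(5)[OF pos(1) x] by simp
qed

section \<open>Completing the square in the Lagrangian\<close>

text \<open>Sorting by degree in \<open>v\<close>: the objective and the constraints
  \<open>Q v \<ge> e\<close> contribute the slope \<open>p\<close>, the centers of the ellipsoids
  contribute \<open>- 2 q\<close>.\<close>

lemma lagrangian_expand:
  fixes \<xi> lam \<beta> v :: "real vec"
  assumes \<xi>: "\<xi> \<in> carrier_vec d" and \<beta>: "\<beta> \<in> carrier_vec k" and v: "v \<in> carrier_vec d"
  defines "p \<equiv> \<xi> - transpose_mat Q *\<^sub>v \<beta>"
    and "q \<equiv> finsum_vec TYPE(real) d (\<lambda>i. lam $ i \<cdot>\<^sub>v (P i *\<^sub>v vb i)) {..<l}"
  shows "q \<in> carrier_vec d"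
    and "lagrangian \<xi> lam \<beta> v = v \<bullet> (W lam *\<^sub>v v) + p \<bullet> v - 2 * (q \<bullet> v) + \<beta> \<bullet> e
           + (\<Sum>i<l. lam $ i * (vb i \<bullet> (P i *\<^sub>v vb i)) - lam $ i * (r i)\<^sup>2)"
proof -
  have Pvb: "P i *\<^sub>v vb i \<in> carrier_vec d" if "i < l" for i
    using precision(2)[OF that] center[OF that] by simp
  show q: "q \<in> carrier_vec d"
    unfolding q_def using Pvb by (intro finsum_vec_closed) auto
  have "q \<bullet> v = (\<Sum>s<d. (\<Sum>i<l. lam $ i * (P i *\<^sub>v vb i) $ s) * v $ s)"
  proof -
    have "q $ s = (\<Sum>i<l. lam $ i * (P i *\<^sub>v vb i) $ s)" if "s < d" for s
    proof -
      have "q $ s = (\<Sum>i<l. (lam $ i \<cdot>\<^sub>v (P i *\<^sub>v vb i)) $ s)"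
        unfolding q_def using Pvb that by (intro index_finsum_vec) auto
      also have "\<dots> = (\<Sum>i<l. lam $ i * (P i *\<^sub>v vb i) $ s)"
        using that carrier_matD(1)[OF precision(2)] by (intro sum.cong refl index_smult_vec(1)) simp
      finally show ?thesis .
    qed
    thus ?thesis using v by (simp add: scalar_prod_def atLeast0LessThan)
  qed
  also have "\<dots> = (\<Sum>i<l. \<Sum>s<d. lam $ i * (P i *\<^sub>v vb i) $ s * v $ s)"
    by (simp add: sum_distrib_right) (rule sum.swap)
  also have "\<dots> = (\<Sum>i<l. lam $ i * (v \<bullet> (P i *\<^sub>v vb i)))"
  proof (intro sum.cong refl)
    fix i assume "i \<in> {..<l}"
    thus "(\<Sum>s<d. lam $ i * (P i *\<^sub>v vb i) $ s * v $ s) = lam $ i * (v \<bullet> (P i *\<^sub>v vb i))"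
      using Pvb[of i] v comm_scalar_prod[OF v Pvb[of i]]
      by (simp add: scalar_prod_def sum_distrib_left atLeast0LessThan mult_ac)
  qed
  finally have qv: "q \<bullet> v = (\<Sum>i<l. lam $ i * (v \<bullet> (P i *\<^sub>v vb i)))" .
  have sq: "(v - vb i) \<bullet> (P i *\<^sub>v (v - vb i))
      = v \<bullet> (P i *\<^sub>v v) - 2 * (v \<bullet> (P i *\<^sub>v vb i)) + vb i \<bullet> (P i *\<^sub>v vb i)" if "i < l" for i
    using v center[OF that] precision(2)[OF that]
      symmetric_form_commute[OF precision(2,3)[OF that] v center[OF that]]
    by (simp add: vec_bilinear_simps[where d = d])
  have "(\<Sum>i<l. lam $ i * ((v - vb i) \<bullet> (P i *\<^sub>v (v - vb i)) - (r i)\<^sup>2))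
      = (\<Sum>i<l. lam $ i * (v \<bullet> (P i *\<^sub>v v)) - 2 * (lam $ i * (v \<bullet> (P i *\<^sub>v vb i)))
          + (lam $ i * (vb i \<bullet> (P i *\<^sub>v vb i)) - lam $ i * (r i)\<^sup>2))"
    by (intro sum.cong refl) (simp add: sq right_diff_distrib distrib_left)
  also have "\<dots> = v \<bullet> (W lam *\<^sub>v v) - 2 * (q \<bullet> v)
      + (\<Sum>i<l. lam $ i * (vb i \<bullet> (P i *\<^sub>v vb i)) - lam $ i * (r i)\<^sup>2)"
    by (simp add: qv weighted_precision_form[OF v v] sum.distrib sum_subtractf sum_distrib_left)
  finally have quad: "(\<Sum>i<l. lam $ i * ((v - vb i) \<bullet> (P i *\<^sub>v (v - vb i)) - (r i)\<^sup>2)) = \<dots>" .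
  have "p \<bullet> v = \<xi> \<bullet> v - \<beta> \<bullet> (Q *\<^sub>v v)"
    using transpose_vec_mult_scalar[OF Q v \<beta>] \<xi> v \<beta> Q
    by (simp add: p_def vec_bilinear_simps[where d = d])
  moreover have "\<beta> \<bullet> (e - Q *\<^sub>v v) = \<beta> \<bullet> e - \<beta> \<bullet> (Q *\<^sub>v v)"
    using \<beta> e Q v by (simp add: scalar_prod_minus_distrib[of _ k])
  ultimately show "lagrangian \<xi> lam \<beta> v = v \<bullet> (W lam *\<^sub>v v) + p \<bullet> v - 2 * (q \<bullet> v) + \<beta> \<bullet> e
           + (\<Sum>i<l. lam $ i * (vb i \<bullet> (P i *\<^sub>v vb i)) - lam $ i * (r i)\<^sup>2)"
    unfolding lagrangian_def quad by simp
qed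

text \<open>An exact identity serves both directions: dropping the square bounds the Lagrangian from
  below, and evaluating at \<open>w\<close> attains the bound.\<close>

lemma lagrangian_complete_square:
  assumes \<xi>: "\<xi> \<in> carrier_vec d" and \<beta>: "\<beta> \<in> carrier_vec k"
    and inv: "invertible_mat (W lam)"
  shows "\<exists>w\<in>carrier_vec d. \<forall>v\<in>carrier_vec d.
    lagrangian \<xi> lam \<beta> v = dual_formula d l vb S r Q e \<xi> lam \<beta> + (v - w) \<bullet> (W lam *\<^sub>v (v - w))"
proof -
  define p where "p = \<xi> - transpose_mat Q *\<^sub>v \<beta>"
  define q where "q = finsum_vec TYPE(real) d (\<lambda>i. lam $ i \<cdot>\<^sub>v (P i *\<^sub>v vb i)) {..<l}"
  define T where "T = minv (W lam)"
  note cW = weighted_precision_carrier[of lam]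
  have p: "p \<in> carrier_vec d" using \<xi> \<beta> Q by (simp add: p_def)
  have q: "q \<in> carrier_vec d" using lagrangian_expand(1)[OF \<xi> \<beta> \<xi>] by (simp add: q_def)
  have T: "T \<in> carrier_mat d d" "transpose_mat T = T"
    using minv_inverse(1)[OF cW inv] minv_symmetric[OF cW inv weighted_precision_symmetric]
    by (auto simp: T_def)
  \<comment> \<open>Stationarity reads \<open>2 W v + p - 2 q = 0\<close>, so the critical point
    \<open>w\<close> satisfies \<open>W w = q - p / 2\<close>.\<close>
  define u where "u = q - (1/2) \<cdot>\<^sub>v p"
  have u: "u \<in> carrier_vec d" using p q by (simp add: u_def)
  define w where "w = T *\<^sub>v u"
  have w: "w \<in> carrier_vec d" using T u by (simp add: w_def)
  have uTu: "u \<bullet> (T *\<^sub>v u) = q \<bullet> (T *\<^sub>v q) - p \<bullet> (T *\<^sub>v q) + 1/4 * (p \<bullet> (T *\<^sub>v p))"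
    using p q T symmetric_form_commute[OF T p q]
    by (simp add: u_def vec_bilinear_simps[where d = d] algebra_simps)
  have Ww: "W lam *\<^sub>v w = u"
    using minv_cancel(1)[OF cW inv u] by (simp add: w_def T_def)
  have "lagrangian \<xi> lam \<beta> v
      = dual_formula d l vb S r Q e \<xi> lam \<beta> + (v - w) \<bullet> (W lam *\<^sub>v (v - w))"
    if v: "v \<in> carrier_vec d" for v
  proof -
    have "(v - w) \<bullet> (W lam *\<^sub>v (v - w)) = v \<bullet> (W lam *\<^sub>v v) - 2 * (u \<bullet> v) + u \<bullet> (T *\<^sub>v u)"
      using v w u cW Ww symmetric_form_commute[OF cW weighted_precision_symmetric v w]
        comm_scalar_prod[OF v u] comm_scalar_prod[OF w u]
      by (simp add: vec_bilinear_simps[where d = d] w_def[symmetric])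
    moreover have "2 * (u \<bullet> v) = 2 * (q \<bullet> v) - p \<bullet> v"
      using p q v by (simp add: u_def vec_bilinear_simps[where d = d])
    ultimately show ?thesis
      using uTu unfolding lagrangian_expand(2)[OF \<xi> \<beta> v] dual_formula_def Let_def
        p_def[symmetric] q_def[symmetric] T_def[symmetric]
      by simp
  qed
  thus ?thesis using w by blast
qed

text \<open>Together with the next lemma this identifies \<open>group_dual\<close> with the infimum
  of the Lagrangian over all \<open>v\<close>. If \<open>W lam\<close> is singular, the weights
  vanish and the Lagrangian is affine with slope \<open>p\<close>, hence constant for
  \<open>p = 0\<close>.\<close>

lemma group_dual_le_lagrangian:
  assumes \<xi>: "\<xi> \<in> carrier_vec d" and lam: "0\<^sub>v l \<le> lam" and \<beta>: "\<beta> \<in> carrier_vec k"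
    and v: "v \<in> carrier_vec d"
  shows "group_dual d l vb S r Q e \<xi> lam \<beta> \<le> ereal (lagrangian \<xi> lam \<beta> v)"
proof (cases "invertible_mat (W lam)")
  case True
  then obtain w where "w \<in> carrier_vec d" "lagrangian \<xi> lam \<beta> v
      = dual_formula d l vb S r Q e \<xi> lam \<beta> + (v - w) \<bullet> (W lam *\<^sub>v (v - w))"
    using lagrangian_complete_square[OF \<xi> \<beta>] v by blast
  thus ?thesis using True v weighted_precision_nonneg[OF lam, of "v - w"]
    by (simp add: group_dual_def)
next
  case False
  show ?thesis
  proof (cases "\<xi> - transpose_mat Q *\<^sub>v \<beta> = 0\<^sub>v d")
    case p: True
    have "lam $ i = 0" if "i < l" for i
      using False weighted_precision_invertible[OF lam that] by blast
    hence "lagrangian \<xi> lam \<beta> v = \<xi> \<bullet> v + \<beta> \<bullet> (e - Q *\<^sub>v v)"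
      by (simp add: lagrangian_def)
    also have "\<dots> = (\<xi> - transpose_mat Q *\<^sub>v \<beta>) \<bullet> v + \<beta> \<bullet> e"
      using transpose_vec_mult_scalar[OF Q v \<beta>] \<xi> v \<beta> Q e
      by (simp add: minus_scalar_prod_distrib[of _ d] scalar_prod_minus_distrib[of _ k])
    finally have "lagrangian \<xi> lam \<beta> v = \<beta> \<bullet> e" using p v by simp
    thus ?thesis using p False by (simp add: group_dual_def)
  qed (use False in \<open>simp add: group_dual_def\<close>)
qed

text \<open>In the regular case the bound is evaluated at the center of the square. In the singular
  case the Lagrangian is affine, and an affine function bounded below has slope zero, which excludes
  the value \<open>- \<infinity>\<close>.\<close>

lemma le_group_dual_if_le_lagrangian:
  assumes \<xi>: "\<xi> \<in> carrier_vec d" and lam: "0\<^sub>v l \<le> lam" and \<beta>: "\<beta> \<in> carrier_vec k"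
    and bound: "\<And>v. v \<in> carrier_vec d \<Longrightarrow> \<tau> \<le> lagrangian \<xi> lam \<beta> v"
  shows "ereal \<tau> \<le> group_dual d l vb S r Q e \<xi> lam \<beta>"
proof (cases "invertible_mat (W lam)")
  case True
  then obtain w where w: "w \<in> carrier_vec d" "lagrangian \<xi> lam \<beta> w
      = dual_formula d l vb S r Q e \<xi> lam \<beta> + (w - w) \<bullet> (W lam *\<^sub>v (w - w))"
    using lagrangian_complete_square[OF \<xi> \<beta>] by blast
  moreover have "(w - w) \<bullet> (W lam *\<^sub>v (w - w)) = 0"
    using w(1) weighted_precision_carrier[of lam] by (simp add: scalar_prod_left_zero[of _ d])
  ultimately show ?thesis using True bound[OF w(1)] by (simp add: group_dual_def)
next
  case False
  define p where "p = \<xi> - transpose_mat Q *\<^sub>v \<beta>"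
  have p: "p \<in> carrier_vec d" using \<xi> \<beta> Q by (simp add: p_def)
  have lam0: "lam $ i = 0" if "i < l" for i
    using False weighted_precision_invertible[OF lam that] by blast
  have affine: "\<tau> \<le> p \<bullet> v + \<beta> \<bullet> e" if v: "v \<in> carrier_vec d" for v
  proof -
    have "lagrangian \<xi> lam \<beta> v = \<xi> \<bullet> v + \<beta> \<bullet> (e - Q *\<^sub>v v)"
      using lam0 by (simp add: lagrangian_def)
    also have "\<dots> = p \<bullet> v + \<beta> \<bullet> e"
      using transpose_vec_mult_scalar[OF Q v \<beta>] \<xi> v \<beta> Q e
      by (simp add: p_def minus_scalar_prod_distrib[of _ d] scalar_prod_minus_distrib[of _ k])
    finally show ?thesis using bound[OF v] by simp
  qed
  have "p $ i = 0" if i: "i < d" for i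
  proof (rule ccontr)
    assume nz: "p $ i \<noteq> 0"
    \<comment> \<open>Chosen so that the affine function takes the value \<open>\<tau> - 1\<close>
      at \<open>s\<close> times the unit vector.\<close>
    define s where "s = (\<tau> - \<beta> \<bullet> e - 1) / p $ i"
    have "\<tau> \<le> p \<bullet> (s \<cdot>\<^sub>v unit_vec d i) + \<beta> \<bullet> e" by (intro affine) simp
    also have "p \<bullet> (s \<cdot>\<^sub>v unit_vec d i) = s * p $ i"
      using p i by (simp add: scalar_prod_smult_distrib[of _ d])
    finally show False using nz by (simp add: s_def)
  qed
  hence p0: "p = 0\<^sub>v d" using p by (intro eq_vecI) auto
  have "\<tau> \<le> \<beta> \<bullet> e" using affine[of "0\<^sub>v d"] p by simp
  thus ?thesis using False p0 by (simp add: group_dual_def p_def)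
qed

section \<open>Weak and strong duality for one group\<close>

lemma group_dual_le_on_uncertainty:
  assumes \<xi>: "\<xi> \<in> carrier_vec d" and lam: "0\<^sub>v l \<le> lam"
    and \<beta>: "\<beta> \<in> carrier_vec k" "0\<^sub>v k \<le> \<beta>"
    and v: "v \<in> group_uncertainty d l vb S r Q e"
  shows "group_dual d l vb S r Q e \<xi> lam \<beta> \<le> ereal (\<xi> \<bullet> v)"
proof -
  have cv: "v \<in> carrier_vec d" using v by (simp add: group_uncertainty_def)
  have "0 \<le> \<beta> \<bullet> (Q *\<^sub>v v - e)"
    using v Q e by (intro scalar_prod_nonneg[OF \<beta>(2)]) (auto simp: group_uncertainty_def less_eq_vec_def)
  moreover have "\<beta> \<bullet> (Q *\<^sub>v v - e) = - (\<beta> \<bullet> (e - Q *\<^sub>v v))"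
    using \<beta> Q e cv by (simp add: scalar_prod_minus_distrib[of _ k])
  moreover have "(\<Sum>i<l. lam $ i * ((v - vb i) \<bullet> (P i *\<^sub>v (v - vb i)) - (r i)\<^sup>2)) \<le> 0"
    using lam v
    by (intro sum_nonpos mult_nonneg_nonpos) (auto simp: group_uncertainty_def less_eq_vec_def)
  ultimately have "lagrangian \<xi> lam \<beta> v \<le> \<xi> \<bullet> v" by (simp add: lagrangian_def)
  thus ?thesis
    using group_dual_le_lagrangian[OF \<xi> lam \<beta>(1) cv] by (metis ereal_less_eq(3) order_trans)
qed

text \<open>\<open>multipliers\<close> is applied to the objective \<open>a v - \<tau>\<close>,
  nonnegative on the uncertainty set. The multipliers of the sign constraints form \<open>s\<close>;
  the other two families form \<open>lam\<close> and \<open>\<beta>\<close>, and what remains is the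
  Lagrangian at \<open>a - s\<close>.\<close>

lemma group_strong_duality:
  assumes a: "a \<in> carrier_vec d" and slater: "strictly_feasible d l k vb S r Q e"
    and bound: "\<And>v. v \<in> group_uncertainty d l vb S r Q e \<Longrightarrow> \<tau> \<le> a \<bullet> v"
  shows "\<exists>s lam \<beta>. s \<in> carrier_vec d \<and> 0\<^sub>v d \<le> s \<and> lam \<in> carrier_vec l \<and> 0\<^sub>v l \<le> lam \<and>
    \<beta> \<in> carrier_vec k \<and> 0\<^sub>v k \<le> \<beta> \<and> ereal \<tau> \<le> group_dual d l vb S r Q e (a - s) lam \<beta>"
proof -
  \<comment> \<open>The sum type indexes the ellipsoids, the rows of \<open>Q\<close> and the
    coordinates. Linear constraints are written in the shape of \<open>convex_along_affine\<close>,
    which explains the summand \<open>0\<close>.\<close>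
  define g :: "nat + nat + nat \<Rightarrow> real vec \<Rightarrow> real" where
    "g = case_sum (\<lambda>i v. (v - vb i) \<bullet> (P i *\<^sub>v (v - vb i)) - (r i)\<^sup>2)
       (case_sum (\<lambda>s v. e $ s + (- row Q s) \<bullet> v) (\<lambda>t v. 0 + (- unit_vec d t) \<bullet> v))"
  have g_simps: "g (Inl i) v = (v - vb i) \<bullet> (P i *\<^sub>v (v - vb i)) - (r i)\<^sup>2"
    "s < k \<Longrightarrow> v \<in> carrier_vec d \<Longrightarrow> g (Inr (Inl s)) v = e $ s - (Q *\<^sub>v v) $ s"
    "t < d \<Longrightarrow> v \<in> carrier_vec d \<Longrightarrow> g (Inr (Inr t)) v = - v $ t" for i s t v
    using Q by (auto simp: g_def)
  define K :: "(nat + nat + nat) set" where "K = {..<l} <+> {..<k} <+> {..<d}"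
  obtain v0 where v0: "v0 \<in> carrier_vec d"
    "\<And>i. i < l \<Longrightarrow> (v0 - vb i) \<bullet> (P i *\<^sub>v (v0 - vb i)) < (r i)\<^sup>2"
    "\<And>s. s < k \<Longrightarrow> e $ s < (Q *\<^sub>v v0) $ s" "\<And>t. t < d \<Longrightarrow> 0 < v0 $ t"
    using slater unfolding strictly_feasible_def by blast
  have "\<exists>u. (\<forall>i\<in>K. 0 \<le> u i) \<and>
      (\<forall>v\<in>carrier_vec d. 0 \<le> (- \<tau> + a \<bullet> v) + (\<Sum>i\<in>K. u i * g i v))"
  proof (rule multipliers[where mix = convex_comb and ?x0.0 = v0])
    show "finite K" by (simp add: K_def)
    show "convex_along convex_comb (carrier_vec d) (\<lambda>v. - \<tau> + a \<bullet> v)"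
      by (rule convex_along_affine[OF a])
    show "convex_along convex_comb (carrier_vec d) (g i)" if "i \<in> K" for i
    proof -
      consider (ell) j where "i = Inl j" "j < l" | (lin) s where "i = Inr (Inl s)" "s < k"
        | (pos) t where "i = Inr (Inr t)" "t < d"
        using \<open>i \<in> K\<close> by (auto simp: K_def)
      thus ?thesis
      proof cases
        case ell
        thus ?thesis using convex_along_quadratic[OF precision(1) center] by (simp add: g_def)
      next
        case lin
        thus ?thesis using convex_along_affine[of "- row Q s" d "e $ s"] Q by (simp add: g_def)
      next
        case pos
        thus ?thesis using convex_along_affine[of "- unit_vec d t" d 0] by (simp add: g_def)
      qed
    qed
    show "v0 \<in> carrier_vec d" by fact
    show "g i v0 < 0" if "i \<in> K" for i
      using that v0 by (auto simp: K_def g_simps simp del: index_mult_mat_vec)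
    show "0 \<le> - \<tau> + a \<bullet> v"
      if v: "v \<in> carrier_vec d" and feas: "\<And>i. i \<in> K \<Longrightarrow> g i v \<le> 0" for v
    proof -
      have "(v - vb i) \<bullet> (P i *\<^sub>v (v - vb i)) \<le> (r i)\<^sup>2" if "i < l" for i
        using feas[of "Inl i"] that by (auto simp: K_def g_simps)
      moreover have "e $ s \<le> (Q *\<^sub>v v) $ s" if "s < k" for s
        using feas[of "Inr (Inl s)"] that v by (auto simp: K_def g_simps simp del: index_mult_mat_vec)
      moreover have "0 \<le> v $ t" if "t < d" for t
        using feas[of "Inr (Inr t)"] that v by (auto simp: K_def g_simps)
      ultimately have "v \<in> group_uncertainty d l vb S r Q e"
        using v Q e by (auto simp: group_uncertainty_def less_eq_vec_def)
      thus ?thesis using bound by fastforce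
    qed
  qed
  then obtain u where u: "\<And>i. i \<in> K \<Longrightarrow> 0 \<le> u i"
    "\<And>v. v \<in> carrier_vec d \<Longrightarrow> \<tau> \<le> a \<bullet> v + (\<Sum>i\<in>K. u i * g i v)" by force
  define lam where "lam = vec l (\<lambda>i. u (Inl i))"
  define \<beta> where "\<beta> = vec k (\<lambda>i. u (Inr (Inl i)))"
  define s where "s = vec d (\<lambda>i. u (Inr (Inr i)))"
  have car: "lam \<in> carrier_vec l" "\<beta> \<in> carrier_vec k" "s \<in> carrier_vec d"
    by (simp_all add: lam_def \<beta>_def s_def)
  have nonneg: "0\<^sub>v l \<le> lam" "0\<^sub>v k \<le> \<beta>" "0\<^sub>v d \<le> s"
    using u(1) by (auto simp: lam_def \<beta>_def s_def K_def less_eq_vec_def)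
  have "\<tau> \<le> lagrangian (a - s) lam \<beta> v" if v: "v \<in> carrier_vec d" for v
  proof -
    have "(\<Sum>i\<in>K. u i * g i v) = (\<Sum>i<l. lam $ i * ((v - vb i) \<bullet> (P i *\<^sub>v (v - vb i)) - (r i)\<^sup>2))
        + (\<Sum>i<k. \<beta> $ i * (e $ i - (Q *\<^sub>v v) $ i)) + (\<Sum>i<d. s $ i * (- v $ i))"
      using v by (simp add: K_def sum.Plus g_simps lam_def \<beta>_def s_def del: index_mult_mat_vec)
    also have "(\<Sum>i<k. \<beta> $ i * (e $ i - (Q *\<^sub>v v) $ i)) = \<beta> \<bullet> (e - Q *\<^sub>v v)"
      using Q e by (simp add: scalar_prod_def[of \<beta>] atLeast0LessThan del: index_mult_mat_vec)
    also have "(\<Sum>i<d. s $ i * (- v $ i)) = - (s \<bullet> v)"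
      using v by (simp add: scalar_prod_def atLeast0LessThan sum_negf)
    finally show ?thesis
      using u(2)[OF v] a v car by (simp add: lagrangian_def minus_scalar_prod_distrib[of _ d])
  qed
  hence "ereal \<tau> \<le> group_dual d l vb S r Q e (a - s) lam \<beta>"
    using a car nonneg by (intro le_group_dual_if_le_lagrangian) auto
  thus ?thesis using car nonneg by blast
qed

text \<open>Used to restrict the dual to points where the formula is literally defined. A singular
  \<open>lam\<close> either has value \<open>- \<infinity>\<close>, so the all-ones weights do at
  least as well, or has \<open>p = 0\<close>, where small positive weights cost at most
  \<open>\<delta>\<close>.\<close>

lemma group_dual_regularize:
  assumes l: "0 < l" and \<delta>: "0 < \<delta>"
    and \<xi>: "\<xi> \<in> carrier_vec d" and lam: "lam \<in> carrier_vec l" "0\<^sub>v l \<le> lam"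
    and \<beta>: "\<beta> \<in> carrier_vec k"
  shows "\<exists>mu. mu \<in> carrier_vec l \<and> 0\<^sub>v l \<le> mu \<and> invertible_mat (W mu) \<and>
    group_dual d l vb S r Q e \<xi> lam \<beta> \<le> group_dual d l vb S r Q e \<xi> mu \<beta> + ereal \<delta>"
proof (cases "invertible_mat (W lam) \<or> \<xi> - transpose_mat Q *\<^sub>v \<beta> \<noteq> 0\<^sub>v d")
  case True
  thus ?thesis
  proof (cases "invertible_mat (W lam)")
    case True
    thus ?thesis using lam \<delta>
      by (intro exI[of _ lam]) (simp add: group_dual_def)
  next
    case False
    hence "group_dual d l vb S r Q e \<xi> lam \<beta> = - \<infinity>"
      using True by (simp add: group_dual_def)
    moreover have "invertible_mat (W (vec l (\<lambda>_. 1)))"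
      using l by (intro weighted_precision_invertible[of _ 0]) (auto simp: less_eq_vec_def)
    ultimately show ?thesis
      by (intro exI[of _ "vec l (\<lambda>_. 1)"]) (auto simp: less_eq_vec_def)
  qed
next
  case False
  hence p: "\<xi> - transpose_mat Q *\<^sub>v \<beta> = 0\<^sub>v d" by simp
  \<comment> \<open>Here \<open>\<lambda> = 0\<close>; moving to \<open>\<lambda> = (\<epsilon>, \<dots>, \<epsilon>)\<close> lowers the Lagrangian by at most \<open>\<epsilon> * R\<close>.\<close>
  define R where "R = (\<Sum>i<l. (r i)\<^sup>2)"
  have R: "0 \<le> R" by (simp add: R_def sum_nonneg)
  define \<epsilon> where "\<epsilon> = \<delta> / (R + 1)"
  have \<epsilon>: "0 < \<epsilon>" "\<epsilon> * R \<le> \<delta>" using \<delta> R by (auto simp: \<epsilon>_def field_simps)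
  define mu where "mu = vec l (\<lambda>_. \<epsilon>)"
  have mu: "mu \<in> carrier_vec l" "0\<^sub>v l \<le> mu"
    using \<epsilon> by (auto simp: mu_def less_eq_vec_def)
  have inv: "invertible_mat (W mu)"
    using l mu(2) \<epsilon> by (intro weighted_precision_invertible[of _ 0]) (auto simp: mu_def)
  have "\<beta> \<bullet> e - \<delta> \<le> lagrangian \<xi> mu \<beta> v" if v: "v \<in> carrier_vec d" for v
  proof -
    have "- (\<epsilon> * R) = (\<Sum>i<l. - (\<epsilon> * (r i)\<^sup>2))" by (simp add: R_def sum_distrib_left sum_negf)
    also have "\<dots> \<le> (\<Sum>i<l. mu $ i * ((v - vb i) \<bullet> (P i *\<^sub>v (v - vb i)) - (r i)\<^sup>2))"
    proof (intro sum_mono)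
      fix i assume i: "i \<in> {..<l}"
      hence "0 \<le> \<epsilon> * ((v - vb i) \<bullet> (P i *\<^sub>v (v - vb i)))"
        using \<epsilon> v center[of i] precision(4)[of i "v - vb i"] by simp
      thus "- (\<epsilon> * (r i)\<^sup>2) \<le> mu $ i * ((v - vb i) \<bullet> (P i *\<^sub>v (v - vb i)) - (r i)\<^sup>2)"
        using i by (simp add: mu_def algebra_simps)
    qed
    finally have "- \<delta> \<le> (\<Sum>i<l. mu $ i * ((v - vb i) \<bullet> (P i *\<^sub>v (v - vb i)) - (r i)\<^sup>2))"
      using \<epsilon> by linarith
    moreover have "\<xi> \<bullet> v + \<beta> \<bullet> (e - Q *\<^sub>v v) = (\<xi> - transpose_mat Q *\<^sub>v \<beta>) \<bullet> v + \<beta> \<bullet> e"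
      using transpose_vec_mult_scalar[OF Q v \<beta>] \<xi> v \<beta> Q e
      by (simp add: minus_scalar_prod_distrib[of _ d] scalar_prod_minus_distrib[of _ k])
    ultimately show ?thesis using p v by (simp add: lagrangian_def)
  qed
  hence "ereal (\<beta> \<bullet> e - \<delta>) \<le> group_dual d l vb S r Q e \<xi> mu \<beta>"
    by (rule le_group_dual_if_le_lagrangian[OF \<xi> mu(2) \<beta>])
  moreover have "group_dual d l vb S r Q e \<xi> lam \<beta> = ereal (\<beta> \<bullet> e)"
    using False p by (simp add: group_dual_def)
  ultimately have "group_dual d l vb S r Q e \<xi> lam \<beta> \<le> group_dual d l vb S r Q e \<xi> mu \<beta> + ereal \<delta>"
    by (cases "group_dual d l vb S r Q e \<xi> mu \<beta>") auto
  thus ?thesis using mu inv by blast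
qed

lemma strictly_feasible_imp_nonempty:
  assumes "strictly_feasible d l k vb S r Q e"
  shows "group_uncertainty d l vb S r Q e \<noteq> {}"
proof -
  obtain v where v: "v \<in> carrier_vec d"
    "\<And>i. i < l \<Longrightarrow> (v - vb i) \<bullet> (P i *\<^sub>v (v - vb i)) < (r i)\<^sup>2"
    "\<And>s. s < k \<Longrightarrow> e $ s < (Q *\<^sub>v v) $ s" "\<And>t. t < d \<Longrightarrow> 0 < v $ t"
    using assms unfolding strictly_feasible_def by blast
  have "e \<le> Q *\<^sub>v v" "0\<^sub>v d \<le> v"
    using Q e v(1) less_imp_le[OF v(3)] less_imp_le[OF v(4)] unfolding less_eq_vec_def
    by (simp_all del: index_mult_mat_vec)
  hence "v \<in> group_uncertainty d l vb S r Q e"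
    using v(1) less_imp_le[OF v(2)] by (simp add: group_uncertainty_def)
  thus ?thesis by blast
qed

end

subsection \<open>Decomposition into blocks\<close>

lemma less_eq_vec_index:
  fixes x y :: "real vec"
  assumes "x \<le> y" "y \<in> carrier_vec N" "i < N"
  shows "x $ i \<le> y $ i"
  using assms by (auto simp: less_eq_vec_def)

text \<open>For a partition, the pairs \<open>(G, t)\<close> with \<open>t < card G * m\<close>
  correspond bijectively to the positions below \<open>n * m\<close> of the full vector; the lemmas
  on range, surjectivity and injectivity below establish this.\<close>

definition block_position :: "nat \<Rightarrow> nat set \<Rightarrow> nat \<Rightarrow> nat" where
  "block_position m G t = sorted_list_of_set G ! (t div m) * m + t mod m"

lemma dim_block [simp]: "dim_vec (block m G x) = card G * m"
  by (simp add: block_def)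

lemma block_carrier [simp]: "block m G x \<in> carrier_vec (card G * m)"
  by (rule carrier_vecI) simp

lemma index_block [simp]:
  "t < card G * m \<Longrightarrow> block m G x $ t = x $ block_position m G t"
  by (simp add: block_def entry_def block_position_def)

lemma row_major_less:
  fixes i j m n :: nat
  assumes "j < n" "i < m"
  shows "j * m + i < n * m"
proof -
  have "j * m + i < Suc j * m" using assms(2) by simp
  also have "\<dots> \<le> n * m" using assms(1) by (intro mult_le_mono1) simp
  finally show ?thesis .
qed

lemma block_position_less:
  assumes part: "partition_on {..<n} \<G>" and G: "G \<in> \<G>" and t: "t < card G * m"
  shows "block_position m G t < n * m"
proof -
  have sub: "G \<subseteq> {..<n}" using part G by (auto simp: partition_on_def)
  hence "finite G" by (rule finite_subset) simp
  moreover have "t div m < card G" using t by (simp add: less_mult_imp_div_less)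
  ultimately have "sorted_list_of_set G ! (t div m) \<in> G"
    by (metis nth_mem set_sorted_list_of_set sorted_list_of_set.length_sorted_key_list_of_set)
  moreover have "0 < m" using t by (cases m) auto
  ultimately show ?thesis
    using sub unfolding block_position_def by (intro row_major_less) auto
qed

lemma block_position_surj:
  assumes part: "partition_on {..<n} \<G>" and x: "x < n * m"
  shows "\<exists>G\<in>\<G>. \<exists>t<card G * m. block_position m G t = x"
proof -
  have m: "0 < m" using x by (cases m) auto
  have "x div m < n" using x by (simp add: less_mult_imp_div_less)
  then obtain G where G: "G \<in> \<G>" "x div m \<in> G"
    using part by (auto simp: partition_on_def)
  have "G \<subseteq> {..<n}" using part G by (auto simp: partition_on_def)
  hence fin: "finite G" by (rule finite_subset) simp
  then obtain p where p: "p < card G" "sorted_list_of_set G ! p = x div m"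
    using G(2)
    by (metis in_set_conv_nth set_sorted_list_of_set sorted_list_of_set.length_sorted_key_list_of_set)
  have "block_position m G (p * m + x mod m) = x"
    using p m by (simp add: block_position_def)
  moreover have "p * m + x mod m < card G * m" using p m by (intro row_major_less) auto
  ultimately show ?thesis using G(1) by blast
qed

text \<open>Division by \<open>m\<close> recovers the agent and the remainder recovers the item.
  Disjointness of the groups then determines \<open>G\<close>, and distinctness of its sorted list
  determines the place within it.\<close>

lemma block_position_inj:
  assumes part: "partition_on {..<n} \<G>" and G: "G \<in> \<G>" "G' \<in> \<G>"
    and t: "t < card G * m" "t' < card G' * m"
    and eq: "block_position m G t = block_position m G' t'"
  shows "G = G' \<and> t = t'"
proof -
  have m: "0 < m" using t by (cases m) auto
  have div: "sorted_list_of_set G ! (t div m) = sorted_list_of_set G' ! (t' div m)"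
    using arg_cong[OF eq, of "\<lambda>x. x div m"] m by (simp add: block_position_def)
  have mod: "t mod m = t' mod m"
    using arg_cong[OF eq, of "\<lambda>x. x mod m"] m by (simp add: block_position_def)
  have fin: "finite H" if "H \<in> \<G>" for H
    using part that by (intro finite_subset[of H "{..<n}"]) (auto simp: partition_on_def)
  have lt: "t div m < card G" "t' div m < card G'"
    using t by (simp_all add: less_mult_imp_div_less)
  have "sorted_list_of_set G ! (t div m) \<in> G" "sorted_list_of_set G' ! (t' div m) \<in> G'"
    using lt fin G
    by (metis nth_mem set_sorted_list_of_set sorted_list_of_set.length_sorted_key_list_of_set)+
  hence GG: "G = G'"
    using disjointD[OF partition_onD2[OF part] G] div by auto
  hence "t div m = t' div m"
    using div lt nth_eq_iff_index_eq[of "sorted_list_of_set G" "t div m" "t' div m"] by simp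
  thus ?thesis using GG mod by (metis div_mult_mod_eq)
qed

text \<open>Lets worst cases and slacks be chosen group by group. \<open>pos\<close> inverts the
  bijection by choice, and injectivity makes that choice the intended pair.\<close>

lemma glue_blocks:
  fixes w :: "nat set \<Rightarrow> real vec"
  assumes part: "partition_on {..<n} \<G>"
    and w: "\<And>G. G \<in> \<G> \<Longrightarrow> w G \<in> carrier_vec (card G * m)"
  shows "\<exists>v\<in>carrier_vec (n * m). \<forall>G\<in>\<G>. block m G v = w G"
proof -
  define pos where "pos x = (SOME (G, t). G \<in> \<G> \<and> t < card G * m \<and> block_position m G t = x)" for x
  define v where "v = vec (n * m) (\<lambda>x. case pos x of (G, t) \<Rightarrow> w G $ t)"
  have "block m G v = w G" if G: "G \<in> \<G>" for G
  proof (rule eq_vecI)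
    fix t assume "t < dim_vec (w G)"
    hence t: "t < card G * m" using w[OF G] by simp
    define x where "x = block_position m G t"
    have "case pos x of (G', t') \<Rightarrow> G' \<in> \<G> \<and> t' < card G' * m \<and> block_position m G' t' = x"
      unfolding pos_def by (rule someI[of _ "(G, t)"]) (simp add: G t x_def)
    hence "pos x = (G, t)"
      using block_position_inj[OF part _ G _ t] by (auto simp: x_def)
    thus "block m G v $ t = w G $ t"
      using t block_position_less[OF part G t] by (simp add: v_def x_def)
  qed (use w[OF G] in simp)
  thus ?thesis by (intro bexI[of _ v]) (auto simp: v_def)
qed

lemma block_mono:
  assumes "partition_on {..<n} \<G>" "G \<in> \<G>" "x \<le> y" "y \<in> carrier_vec (n * m)"
  shows "block m G x \<le> block m G y"
  unfolding less_eq_vec_def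
proof (intro conjI allI impI)
  fix t assume "t < dim_vec (block m G y)"
  hence t: "t < card G * m" by simp
  thus "block m G x $ t \<le> block m G y $ t"
    using assms(3,4) block_position_less[OF assms(1,2) t] by (simp add: less_eq_vec_def)
qed simp

lemma nonneg_if_blocks_nonneg:
  assumes part: "partition_on {..<n} \<G>" and x: "x \<in> carrier_vec (n * m)"
    and nonneg: "\<And>G. G \<in> \<G> \<Longrightarrow> 0\<^sub>v (card G * m) \<le> block m G x"
  shows "0\<^sub>v (n * m) \<le> x"
  unfolding less_eq_vec_def
proof (intro conjI allI impI)
  fix i assume "i < dim_vec x"
  hence "i < n * m" using x by simp
  then obtain G t where "G \<in> \<G>" "t < card G * m" "block_position m G t = i"
    using block_position_surj[OF part] by blast
  thus "0\<^sub>v (n * m) $ i \<le> x $ i" using nonneg[of G] \<open>i < n * m\<close> by (auto simp: less_eq_vec_def)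
qed (use x in simp)

lemma block_minus:
  assumes "partition_on {..<n} \<G>" "G \<in> \<G>" "x \<in> carrier_vec (n * m)" "y \<in> carrier_vec (n * m)"
  shows "block m G (x - y) = block m G x - block m G y"
proof (rule eq_vecI)
  fix t assume "t < dim_vec (block m G x - block m G y)"
  hence t: "t < card G * m" by simp
  thus "block m G (x - y) $ t = (block m G x - block m G y) $ t"
    using assms(3,4) block_position_less[OF assms(1,2) t] by simp
qed simp

subsection \<open>Duality for the egalitarian welfare\<close>

text \<open>Bolzano-Weierstrass by induction on the number of coordinates: a further monotone
  subsequence makes the new coordinate converge and keeps the earlier limits.\<close>

lemma coordinatewise_convergent_subsequence:
  fixes x :: "nat \<Rightarrow> nat \<Rightarrow> real"
  assumes "\<And>i. i < N \<Longrightarrow> Bseq (\<lambda>s. x s i)"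
  shows "\<exists>\<phi>. strict_mono (\<phi> :: nat \<Rightarrow> nat) \<and> (\<forall>i<N. convergent (\<lambda>s. x (\<phi> s) i))"
  using assms
proof (induction N)
  case 0
  show ?case by (intro exI[of _ id]) (auto simp: strict_mono_def)
next
  case (Suc N)
  then obtain \<phi> where \<phi>: "strict_mono (\<phi> :: nat \<Rightarrow> nat)"
    "\<And>i. i < N \<Longrightarrow> convergent (\<lambda>s. x (\<phi> s) i)"
    by force
  obtain \<theta> where \<theta>: "strict_mono (\<theta> :: nat \<Rightarrow> nat)" "monoseq (\<lambda>s. x (\<phi> (\<theta> s)) N)"
    using seq_monosub[of "\<lambda>s. x (\<phi> s) N"] by blast
  have "Bseq (\<lambda>s. x (\<phi> (\<theta> s)) N)"
    using Bseq_subseq[OF Suc.prems[of N], of "\<phi> \<circ> \<theta>"] by simp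
  hence last: "convergent (\<lambda>s. x (\<phi> (\<theta> s)) N)"
    using \<theta>(2) by (rule Bseq_monoseq_convergent)
  have "convergent (\<lambda>s. x (\<phi> (\<theta> s)) i)" if "i < Suc N" for i
    using convergent_subseq_convergent[OF \<phi>(2) \<theta>(1), of i] last that
    by (cases "i = N") (auto simp: o_def)
  thus ?case
    using strict_mono_o[OF \<phi>(1) \<theta>(1)] by (intro exI[of _ "\<phi> \<circ> \<theta>"]) (auto simp: o_def)
qed

text \<open>Expressing maximality through the supremum lets equal optimal values transfer maximizers
  between the two problems.\<close>

lemma is_arg_max_iff_Sup:
  fixes f :: "'a \<Rightarrow> 'b::complete_linorder"
  shows "is_arg_max f (\<lambda>x. x \<in> A) x \<longleftrightarrow> x \<in> A \<and> (SUP y\<in>A. f y) \<le> f x"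
  by (auto simp: is_arg_max_linorder SUP_le_iff)

text \<open>The predicate \<open>ellipsoidal_data\<close> takes no argument for the radii, since its
  locale puts no assumption on them.\<close>

locale robust_egalitarian =
  fixes n m l k :: nat
    and \<G> :: "nat set set"
    and \<kappa>lo \<kappa>hi \<psi>lo \<psi>hi :: "nat \<Rightarrow> real" and c :: "real vec"
    and vb :: "nat set \<Rightarrow> nat \<Rightarrow> real vec"
    and S :: "nat set \<Rightarrow> nat \<Rightarrow> real mat"
    and r :: "nat set \<Rightarrow> nat \<Rightarrow> real"
    and Q :: "nat set \<Rightarrow> real mat"
    and e :: "nat set \<Rightarrow> real vec"
  assumes n: "0 < n" and l: "0 < l"
    and part: "partition_on {..<n} \<G>"
    and c: "c \<in> carrier_vec (n * m)"
    and data: "\<And>G. G \<in> \<G> \<Longrightarrow> ellipsoidal_data (card G * m) l k (vb G) (S G) (Q G) (e G)"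
    and slater: "\<And>G. G \<in> \<G> \<Longrightarrow>
           strictly_feasible (card G * m) l k (vb G) (S G) (r G) (Q G) (e G)"
begin

abbreviation "\<A> \<equiv> allocations n m \<kappa>lo \<kappa>hi \<psi>lo \<psi>hi c"
abbreviation "\<Lambda> \<equiv> lower_allocations (n * m) \<A>"
abbreviation "U G \<equiv> group_uncertainty (card G * m) l (vb G) (S G) (r G) (Q G) (e G)"
abbreviation "\<V> \<equiv> product_uncertainty n m \<G> U"
abbreviation "dual_points \<equiv> dual_domain \<G> l k \<Lambda>"
abbreviation "primal \<equiv> robust_welfare m \<G> \<V>"
abbreviation "dual \<equiv> dual_welfare m \<G> l vb S r Q e"
abbreviation "gdual G \<equiv> group_dual (card G * m) l (vb G) (S G) (r G) (Q G) (e G)"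

section \<open>Equality of the primal and dual values\<close>

lemma groups: "finite \<G>" "\<G> \<noteq> {}"
  using part n finite_elements[OF _ part] by (auto simp: partition_on_def)

text \<open>With \<open>primal_le\<close> this treats the robust welfare as a single infimum over
  pairs \<open>(v, G)\<close>; the minimum over the finite nonempty set of groups is
  attained.\<close>

lemma le_primal:
  assumes "\<And>v G. v \<in> \<V> \<Longrightarrow> G \<in> \<G> \<Longrightarrow> x \<le> ereal (block m G a \<bullet> block m G v)"
  shows "x \<le> primal a"
  unfolding robust_welfare_def
proof (rule INF_greatest)
  fix v assume v: "v \<in> \<V>"
  have "(MIN G\<in>\<G>. group_utility m G a v) \<in> (\<lambda>G. group_utility m G a v) ` \<G>"
    using groups by (intro Min_in) auto
  thus "x \<le> ereal (MIN G\<in>\<G>. group_utility m G a v)"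
    using assms[OF v] by (auto simp: group_utility_def)
qed

lemma primal_le:
  assumes "v \<in> \<V>" "G \<in> \<G>"
  shows "primal a \<le> ereal (block m G a \<bullet> block m G v)"
  unfolding robust_welfare_def
  using groups assms by (intro INF_lower2[OF assms(1)]) (auto simp: group_utility_def intro!: Min_le)

lemma le_dual_iff:
  "x \<le> dual (\<xi>, lam, \<beta>) \<longleftrightarrow> (\<forall>G\<in>\<G>. x \<le> gdual G (block m G \<xi>) (lam G) (\<beta> G))"
  using groups by (simp add: dual_welfare_def)

lemma dual_le: "G \<in> \<G> \<Longrightarrow> dual (\<xi>, lam, \<beta>) \<le> gdual G (block m G \<xi>) (lam G) (\<beta> G)"
  using groups by (auto simp: dual_welfare_def intro!: Min_le)

lemma allocation_carrier: "a \<in> \<A> \<Longrightarrow> a \<in> carrier_vec (n * m)"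
  by (simp add: allocations_def)

lemma allocation_bounds:
  assumes "a \<in> \<A>" "i < n * m"
  shows "0 \<le> a $ i" "a $ i \<le> c $ i"
proof -
  have "0\<^sub>v (n * m) \<le> a" "a \<le> c" using assms(1) by (simp_all add: allocations_def)
  from less_eq_vec_index[OF this(1) allocation_carrier[OF assms(1)] assms(2)]
    less_eq_vec_index[OF this(2) c assms(2)]
  show "0 \<le> a $ i" "a $ i \<le> c $ i" using assms(2) by simp_all
qed

lemma weak_duality:
  assumes t: "(\<xi>, lam, \<beta>) \<in> dual_points"
    and le: "\<And>G. G \<in> \<G> \<Longrightarrow> block m G \<xi> \<le> block m G a"
  shows "dual (\<xi>, lam, \<beta>) \<le> primal a"
proof (rule le_primal)
  fix v G assume v: "v \<in> \<V>" and G: "G \<in> \<G>"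
  interpret ellipsoidal_data "card G * m" l k "vb G" "S G" "r G" "Q G" "e G" by (rule data[OF G])
  have vG: "block m G v \<in> U G" using v G by (simp add: product_uncertainty_def)
  have "dual (\<xi>, lam, \<beta>) \<le> gdual G (block m G \<xi>) (lam G) (\<beta> G)"
    by (rule dual_le[OF G])
  also have "\<dots> \<le> ereal (block m G \<xi> \<bullet> block m G v)"
    using t G vG by (intro group_dual_le_on_uncertainty) (auto simp: dual_domain_def)
  also have "\<dots> \<le> ereal (block m G a \<bullet> block m G v)"
    using vG scalar_prod_mono[OF le[OF G], of "card G * m" "block m G v"]
    by (simp add: group_uncertainty_def)
  finally show "dual (\<xi>, lam, \<beta>) \<le> ereal (block m G a \<bullet> block m G v)" .
qed

lemma glue_uncertainty:
  assumes "\<And>G. G \<in> \<G> \<Longrightarrow> w G \<in> U G"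
  shows "\<exists>v\<in>\<V>. \<forall>G\<in>\<G>. block m G v = w G"
proof -
  have "w G \<in> carrier_vec (card G * m)" if "G \<in> \<G>" for G
    using assms[OF that] by (simp add: group_uncertainty_def)
  from glue_blocks[OF part this] obtain v where
    "v \<in> carrier_vec (n * m)" "\<forall>G\<in>\<G>. block m G v = w G" by blast
  thus ?thesis using assms by (intro bexI[of _ v]) (simp_all add: product_uncertainty_def)
qed

lemma strong_duality:
  assumes a: "a \<in> \<A>"
  shows "\<exists>t\<in>dual_points. primal a \<le> dual t"
proof -
  \<comment> \<open>An arbitrary feasible point per group. It shows that the robust welfare is below
    \<open>\<infinity>\<close> and later fills the blocks of the other groups.\<close>
  define w0 where "w0 G = (SOME w. w \<in> U G)" for G
  have w0: "w0 G \<in> U G" if "G \<in> \<G>" for G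
    unfolding w0_def some_in_eq
    by (rule ellipsoidal_data.strictly_feasible_imp_nonempty[OF data[OF that] slater[OF that]])
  obtain v0 where v0: "v0 \<in> \<V>" using glue_uncertainty[of w0] w0 by blast
  obtain G0 where "G0 \<in> \<G>" using groups(2) by blast
  from primal_le[OF v0 this] have "primal a < \<infinity>"
    by (rule order_le_less_trans) simp
  moreover have "0 \<le> primal a"
  proof (rule le_primal)
    fix v G assume v: "v \<in> \<V>" and G: "G \<in> \<G>"
    have "0\<^sub>v (card G * m) \<le> block m G a"
      using allocation_bounds(1)[OF a block_position_less[OF part G]]
      by (auto simp: less_eq_vec_def)
    moreover have "0\<^sub>v (card G * m) \<le> block m G v"
      using v G by (auto simp: product_uncertainty_def group_uncertainty_def)
    ultimately show "0 \<le> ereal (block m G a \<bullet> block m G v)"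
      using scalar_prod_nonneg by simp
  qed
  ultimately obtain \<rho> where \<rho>: "primal a = ereal \<rho>" by (cases "primal a") auto
  have bound: "\<rho> \<le> block m G a \<bullet> u" if G: "G \<in> \<G>" and u: "u \<in> U G" for G u
  proof -
    \<comment> \<open>Because the uncertainty set is a product, \<open>u\<close> can be placed in
      block \<open>G\<close> beside arbitrary feasible blocks, so the common level
      \<open>\<rho>\<close> bounds the utility of \<open>G\<close> on all of
      \<open>U G\<close>.\<close>
    have "(w0(G := u)) H \<in> U H" if "H \<in> \<G>" for H using w0[OF that] u by simp
    from glue_uncertainty[OF this] obtain v where
      v: "v \<in> \<V>" "\<forall>H\<in>\<G>. block m H v = (w0(G := u)) H" by blast
    hence "block m G v = u" using G by simp
    thus ?thesis using primal_le[OF v(1) G, of a] \<rho> by simp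
  qed
  have "\<forall>G\<in>\<G>. \<exists>s lam \<beta>. s \<in> carrier_vec (card G * m) \<and> 0\<^sub>v (card G * m) \<le> s \<and>
      lam \<in> carrier_vec l \<and> 0\<^sub>v l \<le> lam \<and> \<beta> \<in> carrier_vec k \<and> 0\<^sub>v k \<le> \<beta> \<and>
      ereal \<rho> \<le> gdual G (block m G a - s) lam \<beta>"
    using ellipsoidal_data.group_strong_duality[OF data _ slater bound] by simp
  then obtain s lam \<beta> where
    s: "\<And>G. G \<in> \<G> \<Longrightarrow> s G \<in> carrier_vec (card G * m) \<and> 0\<^sub>v (card G * m) \<le> s G" and
    mult: "\<And>G. G \<in> \<G> \<Longrightarrow> lam G \<in> carrier_vec l \<and> 0\<^sub>v l \<le> lam G \<and> \<beta> G \<in> carrier_vec k \<and> 0\<^sub>v k \<le> \<beta> G"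
    and val: "\<And>G. G \<in> \<G> \<Longrightarrow> ereal \<rho> \<le> gdual G (block m G a - s G) (lam G) (\<beta> G)"
    by metis
  \<comment> \<open>The slacks of the groups are glued into one nonnegative \<open>z\<close>, which
    puts \<open>a - z\<close> into \<open>\<Lambda>\<close>.\<close>
  obtain z where z: "z \<in> carrier_vec (n * m)" "\<And>G. G \<in> \<G> \<Longrightarrow> block m G z = s G"
    using glue_blocks[OF part, of s m] s by blast
  have "0\<^sub>v (n * m) \<le> z" using nonneg_if_blocks_nonneg[OF part z(1)] z(2) s by simp
  hence "(a - z, lam, \<beta>) \<in> dual_points"
    using a z(1) mult by (auto simp: dual_domain_def lower_allocations_def)
  moreover have "primal a \<le> dual (a - z, lam, \<beta>)"
    using val block_minus[OF part _ _ z(1)] allocation_carrier[OF a] z(2)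
    by (simp add: le_dual_iff \<rho>)
  ultimately show ?thesis by blast
qed

lemma dual_domain_dominated:
  assumes "(\<xi>, lam, \<beta>) \<in> dual_points"
  shows "\<exists>a\<in>\<A>. \<forall>G\<in>\<G>. block m G \<xi> \<le> block m G a"
proof -
  obtain a s where a: "a \<in> \<A>" and s: "s \<in> carrier_vec (n * m)" "0\<^sub>v (n * m) \<le> s" and \<xi>: "\<xi> = a - s"
    using assms by (auto simp: dual_domain_def lower_allocations_def)
  have "\<xi> \<le> a" using allocation_carrier[OF a] s by (auto simp: \<xi> less_eq_vec_def)
  thus ?thesis using a allocation_carrier[OF a] block_mono[OF part] by blast
qed

text \<open>Every point of either problem is dominated by a point of the other, so the suprema agree
  before any attainment is known.\<close>

lemma primal_eq_dual: "(SUP a\<in>\<A>. primal a) = (SUP t\<in>dual_points. dual t)"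
proof (rule SUP_eq)
  fix t assume t: "t \<in> dual_points"
  obtain \<xi> lam \<beta> where t_eq: "t = (\<xi>, lam, \<beta>)" by (cases t)
  obtain a where "a \<in> \<A>" "\<And>G. G \<in> \<G> \<Longrightarrow> block m G \<xi> \<le> block m G a"
    using dual_domain_dominated[OF t[unfolded t_eq]] by blast
  thus "\<exists>a\<in>\<A>. dual t \<le> primal a"
    using weak_duality[OF t[unfolded t_eq]] unfolding t_eq by blast
qed (rule strong_duality)

text \<open>Regularizing every group with the same \<open>\<delta>\<close> lowers the minimum over
  groups by at most \<open>\<delta>\<close>, and \<open>\<delta>\<close> is arbitrary.\<close>

lemma dual_eq_regular_dual:
  "(SUP t\<in>dual_points. dual t) = (SUP t\<in>{(\<xi>, lam, \<beta>) \<in> dual_points.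
     \<forall>G\<in>\<G>. invertible_mat (weighted_precision (card G * m) l (S G) (lam G))}. dual t)"
  (is "_ = (SUP t\<in>?reg. dual t)")
proof (rule antisym)
  show "(SUP t\<in>?reg. dual t) \<le> (SUP t\<in>dual_points. dual t)" by (intro SUP_subset_mono) auto
  show "(SUP t\<in>dual_points. dual t) \<le> (SUP t\<in>?reg. dual t)"
  proof (rule ereal_le_epsilon2, rule SUP_least)
    fix \<delta> :: real and t assume \<delta>: "0 < \<delta>" and t: "t \<in> dual_points"
    obtain \<xi> lam \<beta> where t_eq: "t = (\<xi>, lam, \<beta>)" by (cases t)
    have "\<forall>G\<in>\<G>. \<exists>mu. mu \<in> carrier_vec l \<and> 0\<^sub>v l \<le> mu \<and>
        invertible_mat (weighted_precision (card G * m) l (S G) mu) \<and>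
        gdual G (block m G \<xi>) (lam G) (\<beta> G) \<le> gdual G (block m G \<xi>) mu (\<beta> G) + ereal \<delta>"
    proof
      fix G assume G: "G \<in> \<G>"
      show "\<exists>mu. mu \<in> carrier_vec l \<and> 0\<^sub>v l \<le> mu \<and>
        invertible_mat (weighted_precision (card G * m) l (S G) mu) \<and>
        gdual G (block m G \<xi>) (lam G) (\<beta> G) \<le> gdual G (block m G \<xi>) mu (\<beta> G) + ereal \<delta>"
        using t G unfolding t_eq dual_domain_def
        by (intro ellipsoidal_data.group_dual_regularize[OF data[OF G] l \<delta>]) auto
    qed
    then obtain mu where
      mu: "\<And>G. G \<in> \<G> \<Longrightarrow> mu G \<in> carrier_vec l \<and> 0\<^sub>v l \<le> mu G \<and>
        invertible_mat (weighted_precision (card G * m) l (S G) (mu G))" and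
      val: "\<And>G. G \<in> \<G> \<Longrightarrow>
        gdual G (block m G \<xi>) (lam G) (\<beta> G) \<le> gdual G (block m G \<xi>) (mu G) (\<beta> G) + ereal \<delta>"
      by metis
    have "dual t - ereal \<delta> \<le> gdual G (block m G \<xi>) (mu G) (\<beta> G)" if G: "G \<in> \<G>" for G
    proof -
      have "dual t \<le> gdual G (block m G \<xi>) (lam G) (\<beta> G)"
        unfolding t_eq by (rule dual_le[OF G])
      also note val[OF G]
      finally show ?thesis by (simp add: ereal_minus_le)
    qed
    hence "dual t - ereal \<delta> \<le> dual (\<xi>, mu, \<beta>)" by (simp add: le_dual_iff)
    also have "\<dots> \<le> (SUP t\<in>?reg. dual t)"
      using t mu by (intro SUP_upper) (auto simp: t_eq dual_domain_def)
    finally show "dual t \<le> (SUP t\<in>?reg. dual t) + ereal \<delta>" by (simp add: ereal_minus_le)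
  qed
qed

section \<open>Attainment of the primal maximum\<close>

lemma block_scalar_prod_tendsto:
  assumes G: "G \<in> \<G>" and lim: "\<And>i. i < n * m \<Longrightarrow> (\<lambda>s. x s $ i) \<longlonglongrightarrow> a $ i"
  shows "(\<lambda>s. block m G (x s) \<bullet> block m G v) \<longlonglongrightarrow> block m G a \<bullet> block m G v"
  using lim block_position_less[OF part G]
  by (auto simp: scalar_prod_def intro!: tendsto_sum tendsto_mult)

lemma allocations_closed:
  assumes x: "\<And>s. x s \<in> \<A>" and a: "a \<in> carrier_vec (n * m)"
    and lim: "\<And>i. i < n * m \<Longrightarrow> (\<lambda>s. x s $ i) \<longlonglongrightarrow> a $ i"
  shows "a \<in> \<A>"
proof -
  have entry: "(\<lambda>s. entry m (x s) j i) \<longlonglongrightarrow> entry m a j i" if "j < n" "i < m" for i j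
    unfolding entry_def by (rule lim[OF row_major_less[OF that]])
  have row: "(\<lambda>s. \<Sum>i<m. entry m (x s) j i) \<longlonglongrightarrow> (\<Sum>i<m. entry m a j i)" if "j < n" for j
    using that by (intro tendsto_sum entry) auto
  have col: "(\<lambda>s. \<Sum>j<n. entry m (x s) j i) \<longlonglongrightarrow> (\<Sum>j<n. entry m a j i)" if "i < m" for i
    using that by (intro tendsto_sum entry) auto
  have "0 \<le> a $ i" "a $ i \<le> c $ i" if "i < n * m" for i
    using allocation_bounds[OF x that] LIMSEQ_le_const[OF lim[OF that]]
      LIMSEQ_le_const2[OF lim[OF that]] by blast+
  hence "0\<^sub>v (n * m) \<le> a" "a \<le> c" using a c by (auto simp: less_eq_vec_def)
  moreover have "\<kappa>lo j \<le> (\<Sum>i<m. entry m a j i) \<and> (\<Sum>i<m. entry m a j i) \<le> \<kappa>hi j" if "j < n" for j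
    using x that
    by (auto simp: allocations_def intro!: LIMSEQ_le_const[OF row] LIMSEQ_le_const2[OF row])
  moreover have "\<psi>lo i \<le> (\<Sum>j<n. entry m a j i) \<and> (\<Sum>j<n. entry m a j i) \<le> \<psi>hi i" if "i < m" for i
    using x that
    by (auto simp: allocations_def intro!: LIMSEQ_le_const[OF col] LIMSEQ_le_const2[OF col])
  ultimately show ?thesis using a by (simp add: allocations_def)
qed

text \<open>The robust welfare is an infimum of continuous functions of \<open>a\<close>, hence
  upper semicontinuous, and \<open>\<A>\<close> is closed and bounded. The proof runs through a
  maximizing sequence.\<close>

lemma primal_attained:
  assumes "\<A> \<noteq> {}"
  shows "\<exists>a\<in>\<A>. (SUP a\<in>\<A>. primal a) \<le> primal a"
proof -
  \<comment> \<open>Taking the values increasing makes each \<open>F N\<close> a lower bound along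
    the whole tail, so it survives the passage to the limit for every fixed \<open>v\<close> and
    \<open>G\<close>.\<close>
  obtain F where F: "incseq F" "range F \<subseteq> primal ` \<A>" "(SUP a\<in>\<A>. primal a) = (SUP s. F s)"
    using Sup_countable_SUP[of "primal ` \<A>"] assms by blast
  hence "\<forall>s. \<exists>x. x \<in> \<A> \<and> F s = primal x" by blast
  from choice[OF this] obtain x where "\<forall>s. x s \<in> \<A> \<and> F s = primal (x s)" ..
  hence x: "x s \<in> \<A>" "F s = primal (x s)" for s by simp_all
  have "Bseq (\<lambda>s. x s $ i)" if "i < n * m" for i
  proof (rule BseqI')
    fix s
    show "norm (x s $ i) \<le> c $ i" using allocation_bounds[OF x(1) that] by simp
  qed
  then obtain \<phi> where \<phi>: "strict_mono (\<phi> :: nat \<Rightarrow> nat)"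
    "\<And>i. i < n * m \<Longrightarrow> convergent (\<lambda>s. x (\<phi> s) $ i)"
    using coordinatewise_convergent_subsequence[of "n * m" "\<lambda>s i. x s $ i"] by blast
  define a where "a = vec (n * m) (\<lambda>i. lim (\<lambda>s. x (\<phi> s) $ i))"
  have lim: "(\<lambda>s. x (\<phi> s) $ i) \<longlonglongrightarrow> a $ i" if "i < n * m" for i
    using \<phi>(2)[OF that] that by (simp add: a_def convergent_LIMSEQ_iff)
  have "a \<in> \<A>"
    by (rule allocations_closed[OF x(1) _ lim]) (simp_all add: a_def)
  moreover have "F N \<le> primal a" for N
  proof (rule le_primal)
    fix v G assume v: "v \<in> \<V>" and G: "G \<in> \<G>"
    have bound: "F N \<le> ereal (block m G (x (\<phi> s)) \<bullet> block m G v)" if "N \<le> s" for s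
    proof -
      have "N \<le> \<phi> s" using that seq_suble[OF \<phi>(1), of s] by linarith
      hence "F N \<le> primal (x (\<phi> s))" using F(1) x(2) by (metis incseqD)
      also have "\<dots> \<le> ereal (block m G (x (\<phi> s)) \<bullet> block m G v)" by (rule primal_le[OF v G])
      finally show ?thesis .
    qed
    have "(\<lambda>s. ereal (block m G (x (\<phi> s)) \<bullet> block m G v))
        \<longlonglongrightarrow> ereal (block m G a \<bullet> block m G v)"
      using block_scalar_prod_tendsto[OF G, of "\<lambda>s. x (\<phi> s)"] lim by (intro tendsto_ereal) auto
    from LIMSEQ_le_const[OF this] bound
    show "F N \<le> ereal (block m G a \<bullet> block m G v)" by blast
  qed
  hence "(SUP a\<in>\<A>. primal a) \<le> primal a" unfolding F(3) by (rule SUP_least)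
  ultimately show ?thesis by blast
qed

lemma equivalence:
  "(SUP a\<in>\<A>. primal a) = (SUP t\<in>dual_points. dual t)
     \<and> (SUP a\<in>\<A>. primal a)
       = (SUP t\<in>{(\<xi>, lam, \<beta>) \<in> dual_points.
              \<forall>G\<in>\<G>. invertible_mat (weighted_precision (card G * m) l (S G) (lam G))}. dual t)
     \<and> (\<A> \<noteq> {} \<longrightarrow>
          (\<exists>a. is_arg_max primal (\<lambda>a. a \<in> \<A>) a) \<and>
          (\<exists>t. is_arg_max dual (\<lambda>t. t \<in> dual_points) t))
     \<and> (\<forall>\<xi> lam \<beta>. is_arg_max dual (\<lambda>t. t \<in> dual_points) (\<xi>, lam, \<beta>) \<longrightarrow>
          (\<exists>a\<in>\<A>. \<forall>G\<in>\<G>. block m G \<xi> \<le> block m G a) \<and>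
          (\<forall>a\<in>\<A>. (\<forall>G\<in>\<G>. block m G \<xi> \<le> block m G a) \<longrightarrow>
             is_arg_max primal (\<lambda>a. a \<in> \<A>) a))"
  unfolding is_arg_max_iff_Sup
proof (intro conjI impI allI ballI)
  show "(SUP a\<in>\<A>. primal a) = (SUP t\<in>dual_points. dual t)" by (rule primal_eq_dual)
  show "(SUP a\<in>\<A>. primal a) = (SUP t\<in>{(\<xi>, lam, \<beta>) \<in> dual_points.
      \<forall>G\<in>\<G>. invertible_mat (weighted_precision (card G * m) l (S G) (lam G))}. dual t)"
    unfolding primal_eq_dual by (rule dual_eq_regular_dual)
next
  assume "\<A> \<noteq> {}"
  then obtain a where a: "a \<in> \<A>" "(SUP a\<in>\<A>. primal a) \<le> primal a"
    using primal_attained by blast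
  thus "\<exists>a. a \<in> \<A> \<and> (SUP a\<in>\<A>. primal a) \<le> primal a" by blast
  \<comment> \<open>The multipliers are unbounded, so the dual maximizer does not come from
    compactness but from strong duality at the primal maximizer.\<close>
  obtain t where t: "t \<in> dual_points" "primal a \<le> dual t" using strong_duality[OF a(1)] by blast
  have "(SUP t\<in>dual_points. dual t) \<le> dual t"
    using order_trans[OF a(2) t(2)] unfolding primal_eq_dual .
  thus "\<exists>t. t \<in> dual_points \<and> (SUP t\<in>dual_points. dual t) \<le> dual t" using t(1) by blast
next
  fix \<xi> lam \<beta>
  assume t: "(\<xi>, lam, \<beta>) \<in> dual_points \<and> (SUP t\<in>dual_points. dual t) \<le> dual (\<xi>, lam, \<beta>)"
  show "\<exists>a\<in>\<A>. \<forall>G\<in>\<G>. block m G \<xi> \<le> block m G a"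
    by (rule dual_domain_dominated[OF conjunct1[OF t]])
  fix a assume a: "a \<in> \<A>" and le: "\<forall>G\<in>\<G>. block m G \<xi> \<le> block m G a"
  show "a \<in> \<A>" by fact
  have "dual (\<xi>, lam, \<beta>) \<le> primal a"
    by (rule weak_duality[OF conjunct1[OF t] bspec[OF le]])
  with conjunct2[OF t] show "(SUP a\<in>\<A>. primal a) \<le> primal a"
    unfolding primal_eq_dual by (rule order_trans)
qed

end

text \<open>The second equality restricts to points where every \<open>T\<close> exists, so the dual
  formula is read literally there. Attainment is claimed for the extended dual, because over regular
  points the supremum may only be approached as some \<open>\<lambda>\<close> tends to zero.\<close>

theorem proposition3p5:
  fixes n m l k :: nat
    and \<G> :: "nat set set"
    and \<kappa>lo \<kappa>hi \<psi>lo \<psi>hi :: "nat \<Rightarrow> real" and c :: "real vec"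
    and vb :: "nat set \<Rightarrow> nat \<Rightarrow> real vec"
    and S :: "nat set \<Rightarrow> nat \<Rightarrow> real mat"
    and r :: "nat set \<Rightarrow> nat \<Rightarrow> real"
    and Q :: "nat set \<Rightarrow> real mat"
    and e :: "nat set \<Rightarrow> real vec"
  defines "\<A> \<equiv> allocations n m \<kappa>lo \<kappa>hi \<psi>lo \<psi>hi c"
    and "\<Lambda> \<equiv> lower_allocations (n * m) (allocations n m \<kappa>lo \<kappa>hi \<psi>lo \<psi>hi c)"
    and "\<V> \<equiv> product_uncertainty n m \<G>
           (\<lambda>G. group_uncertainty (card G * m) l (vb G) (S G) (r G) (Q G) (e G))"
  assumes "n > 0" and "l > 0"
    and "partition_on {..<n} \<G>"
    and "c \<in> carrier_vec (n * m)"
    and "\<And>G i. G \<in> \<G> \<Longrightarrow> i < l \<Longrightarrow>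
           vb G i \<in> carrier_vec (card G * m) \<and> 0\<^sub>v (card G * m) \<le> vb G i"
    and "\<And>G i. G \<in> \<G> \<Longrightarrow> i < l \<Longrightarrow> psd (card G * m) (S G i) \<and> invertible_mat (S G i)"
    and "\<And>G. G \<in> \<G> \<Longrightarrow> Q G \<in> carrier_mat k (card G * m) \<and> e G \<in> carrier_vec k"
    and "\<And>G. G \<in> \<G> \<Longrightarrow>
           strictly_feasible (card G * m) l k (vb G) (S G) (r G) (Q G) (e G)"
  shows
    "(SUP a\<in>\<A>. robust_welfare m \<G> \<V> a)
       = (SUP t\<in>dual_domain \<G> l k \<Lambda>. dual_welfare m \<G> l vb S r Q e t)
     \<and> (SUP a\<in>\<A>. robust_welfare m \<G> \<V> a)
       = (SUP t\<in>{(\<xi>, lam, \<beta>) \<in> dual_domain \<G> l k \<Lambda>.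
              \<forall>G\<in>\<G>. invertible_mat (weighted_precision (card G * m) l (S G) (lam G))}.
            dual_welfare m \<G> l vb S r Q e t)
     \<and> (\<A> \<noteq> {} \<longrightarrow>
          (\<exists>a. is_arg_max (robust_welfare m \<G> \<V>) (\<lambda>a. a \<in> \<A>) a) \<and>
          (\<exists>t. is_arg_max (dual_welfare m \<G> l vb S r Q e)
                 (\<lambda>t. t \<in> dual_domain \<G> l k \<Lambda>) t))
     \<and> (\<forall>\<xi> lam \<beta>.
          is_arg_max (dual_welfare m \<G> l vb S r Q e)
            (\<lambda>t. t \<in> dual_domain \<G> l k \<Lambda>) (\<xi>, lam, \<beta>) \<longrightarrow>
          (\<exists>a\<in>\<A>. \<forall>G\<in>\<G>. block m G \<xi> \<le> block m G a) \<and>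
          (\<forall>a\<in>\<A>. (\<forall>G\<in>\<G>. block m G \<xi> \<le> block m G a) \<longrightarrow>
             is_arg_max (robust_welfare m \<G> \<V>) (\<lambda>a. a \<in> \<A>) a))"
  unfolding assms(1-3)
proof (rule robust_egalitarian.equivalence, rule robust_egalitarian.intro)
  fix G assume G: "G \<in> \<G>"
  show "ellipsoidal_data (card G * m) l k (vb G) (S G) (Q G) (e G)"
    by (rule ellipsoidal_data.intro) (use assms(8-10)[OF G] in blast)+
  show "strictly_feasible (card G * m) l k (vb G) (S G) (r G) (Q G) (e G)"
    by (rule assms(11)[OF G])
qed (rule assms)+

end
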